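(* Let $V$ be a finite-dimensional irreducible $\mathcal{A}$-module of diameter $d$. Pick $a,b$ among $x,y,z$ with $a\neq b$. Then, for every nonzero $v^{b}\in e_{0}^{b}V$ and every $0\leq i\leq d$, the vector $e_{i}^{a}v^{b}$ is nonzero and therefore a basis for $e_{i}^{a}V$. Moreover, the sequence $\{e_{i}^{a}v^{b}\}_{i=0}^{d}$ is a basis for $V$.
   Context: $\mathbb{K}$ is an algebraically closed field of characteristic zero. $\mathcal{A}$ is the unital associative $\mathbb{K}$-algebra with generators $x,y,z$ and relations $xy+yx=2z$, $yz+zy=2x$, $zx+xz=2y$. The diameter of a finite-dimensional irreducible module $V$ is $d=\dim V-1$. For $a\in\{x,y,z\}$ and $n\in\{0,x,y,z\}$ put $\widehat a(n)=1$ if $n\in\{0,a\}$ and $\widehat a(n)=-1$ otherwise. Every finite-dimensional irreducible $\mathcal{A}$-module of diameter $d$ is of exactly one of the following types (isomorphism classes), described by the action on a basis $\{v_i\}_{i=0}^d$, for $0\le i\le d$. Type $B(d)$ ($d$ even): $x.v_i=(-1)^i(d-2i)v_i$, $y.v_i=(d-i+1)v_{i-1}+(i+1)v_{i+1}$, $z.v_i=(-1)^{i-1}(d-i+1)v_{i-1}+(-1)^i(i+1)v_{i+1}$, with $v_{-1}=0=v_{d+1}$. Type $AB(d,n)$ ($n\in\{0,x,y,z\}$): $x.v_i=\widehat x(n)(-1)^{d+i}(2d-2i+1)v_i$, $y.v_i=\widehat y(n)(-1)^d\big((2d-i+2)v_{i-1}+(i+1)v_{i+1}\big)$, $z.v_i=\widehat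 z(n)\big((-1)^{i-1}(2d-i+2)v_{i-1}+(-1)^i(i+1)v_{i+1}\big)$, with $v_{-1}=0$, $v_{d+1}=v_d$. For $a\in\{x,y,z\}$ the action of $a$ on $V$ is diagonalizable with $d+1$ mutually distinct eigenvalues $\theta_0^a,\dots,\theta_d^a$, where $\theta_i^a=(-1)^i(d-2i)$ if $V$ is of type $B(d)$ and $\theta_i^a=\widehat a(n)(-1)^{d+i}(2d-2i+1)$ if $V$ is of type $AB(d,n)$. The primitive idempotent $e_i^a\in\mathrm{End}(V)$ is the projection onto the $\theta_i^a$-eigenspace of $a$ on $V$ that vanishes on the other eigenspaces of $a$. *)

theory Defs
  imports "HOL-Library.Poly_Mapping" "HOL-Computational_Algebra.Computational_Algebra"
begin

datatype gen = Gx | Gy | Gz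

datatype word = Word (letters: "gen list")

instantiation word :: monoid_add
begin

definition "0 = Word []"

definition "u + w = Word (letters u @ letters w)"

instance
  by standard (auto simp: zero_word_def plus_word_def)

end

text \<open>
  The free unital associative algebra on the three generators is the monoid algebra of the
  words; its multiplication is the convolution product of \<^theory>\<open>HOL-Library.Poly_Mapping\<close>.
\<close>

type_synonym 'k free_alg = "word \<Rightarrow>\<^sub>0 'k"

definition free_scalar :: "'k::field \<Rightarrow> 'k free_alg" where
  "free_scalar c = Poly_Mapping.single 0 c"

definition free_gen :: "gen \<Rightarrow> 'k::field free_alg" where
  "free_gen a = Poly_Mapping.single (Word [a]) 1"

inductive_set rel_ideal :: "'k::field free_alg set" where
  zero: "0 \<in> rel_ideal"
| rel_xy: "free_gen Gx * free_gen Gy + free_gen Gy * free_gen Gx - 2 * free_gen Gz \<in> rel_ideal"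
| rel_yz: "free_gen Gy * free_gen Gz + free_gen Gz * free_gen Gy - 2 * free_gen Gx \<in> rel_ideal"
| rel_zx: "free_gen Gz * free_gen Gx + free_gen Gx * free_gen Gz - 2 * free_gen Gy \<in> rel_ideal"
| add: "p \<in> rel_ideal \<Longrightarrow> q \<in> rel_ideal \<Longrightarrow> p + q \<in> rel_ideal"
| mult_left: "p \<in> rel_ideal \<Longrightarrow> r * p \<in> rel_ideal"
| mult_right: "p \<in> rel_ideal \<Longrightarrow> p * r \<in> rel_ideal"

lemma rel_ideal_uminus: "p \<in> rel_ideal \<Longrightarrow> - p \<in> rel_ideal"
  using rel_ideal.mult_left[of p "- 1"] by simp

definition rel_cong :: "'k::field free_alg \<Rightarrow> 'k free_alg \<Rightarrow> bool" where
  "rel_cong p q \<longleftrightarrow> p - q \<in> rel_ideal"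

lemma equivp_rel_cong: "equivp rel_cong"
proof (rule equivpI)
  show "reflp rel_cong"
    by (auto simp: reflp_def rel_cong_def rel_ideal.zero)
  show "symp rel_cong"
    by (auto simp: symp_def rel_cong_def dest: rel_ideal_uminus)
  show "transp rel_cong"
    unfolding transp_def rel_cong_def by (metis diff_add_cancel add_diff_eq rel_ideal.add)
qed

quotient_type (overloaded) 'k acs_alg = "'k::field free_alg" / rel_cong
  by (rule equivp_rel_cong)

lemma lookup_times_zero_word:
  fixes p q :: "'k::field free_alg"
  shows "Poly_Mapping.lookup (p * q) 0 = Poly_Mapping.lookup p 0 * Poly_Mapping.lookup q 0"
proof -
  have eq: "(0 = u + w) \<longleftrightarrow> u = 0 \<and> w = 0" for u w :: word
    by (cases u; cases w) (auto simp: zero_word_def plus_word_def)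
  have "(\<Sum>w. Poly_Mapping.lookup q w when 0 = u + w) = (Poly_Mapping.lookup q 0 when u = 0)"
    for u
    by (cases "u = 0") (simp_all add: eq)
  then show ?thesis
    by (simp add: lookup_mult mult_when)
qed

lemma lookup_free_gen_zero_word: "Poly_Mapping.lookup (free_gen a) 0 = 0"
  by (simp add: free_gen_def lookup_single zero_word_def)

lemma lookup_rel_ideal_zero_word:
  "p \<in> rel_ideal \<Longrightarrow> Poly_Mapping.lookup p 0 = 0"
proof (induction rule: rel_ideal.induct)
  case (add p q)
  then show ?case by (simp add: lookup_add)
qed (simp_all add: lookup_add lookup_minus lookup_times_zero_word lookup_free_gen_zero_word)

instantiation acs_alg :: (field) ring_1
begin

lift_definition zero_acs_alg :: "'a acs_alg" is 0 .

lift_definition one_acs_alg :: "'a acs_alg" is 1 .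

lift_definition plus_acs_alg :: "'a acs_alg \<Rightarrow> 'a acs_alg \<Rightarrow> 'a acs_alg" is "(+)"
  unfolding rel_cong_def by (metis add_diff_add rel_ideal.add)

lift_definition uminus_acs_alg :: "'a acs_alg \<Rightarrow> 'a acs_alg" is uminus
  unfolding rel_cong_def by (metis minus_diff_minus rel_ideal_uminus)

lift_definition minus_acs_alg :: "'a acs_alg \<Rightarrow> 'a acs_alg \<Rightarrow> 'a acs_alg" is "(-)"
proof -
  fix p q r s :: "'a free_alg"
  assume "rel_cong p q" "rel_cong r s"
  then have "(p - q) + - (r - s) \<in> rel_ideal"
    unfolding rel_cong_def by (intro rel_ideal.add rel_ideal_uminus)
  then show "rel_cong (p - r) (q - s)"
    unfolding rel_cong_def by (simp add: algebra_simps)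
qed

lift_definition times_acs_alg :: "'a acs_alg \<Rightarrow> 'a acs_alg \<Rightarrow> 'a acs_alg" is "(*)"
proof -
  fix p q r s :: "'a free_alg"
  assume "rel_cong p q" "rel_cong r s"
  then have "(p - q) * r + q * (r - s) \<in> rel_ideal"
    unfolding rel_cong_def by (intro rel_ideal.add rel_ideal.mult_left rel_ideal.mult_right)
  then show "rel_cong (p * r) (q * s)"
    unfolding rel_cong_def by (simp add: algebra_simps)
qed

instance
proof
  show "(0 :: 'a acs_alg) \<noteq> 1"
  proof (transfer, unfold rel_cong_def)
    show "(0 :: 'a free_alg) - 1 \<notin> rel_ideal"
      by (auto dest!: lookup_rel_ideal_zero_word)
  qed
qed (transfer, simp add: rel_cong_def rel_ideal.zero algebra_simps)+

end

lift_definition alg_gen :: "gen \<Rightarrow> 'k::field acs_alg" is free_gen .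

lift_definition alg_scalar :: "'k::field \<Rightarrow> 'k acs_alg" is free_scalar .

lemma acs_alg_relations:
  "alg_gen Gx * alg_gen Gy + alg_gen Gy * alg_gen Gx = 2 * (alg_gen Gz :: 'k::field acs_alg)"
  "alg_gen Gy * alg_gen Gz + alg_gen Gz * alg_gen Gy = 2 * (alg_gen Gx :: 'k::field acs_alg)"
  "alg_gen Gz * alg_gen Gx + alg_gen Gx * alg_gen Gz = 2 * (alg_gen Gy :: 'k::field acs_alg)"
  unfolding mult_2
  by (transfer, simp add: rel_cong_def rel_ideal.intros flip: mult_2)+

text \<open>
  The value \<^term>\<open>None\<close> of type \<^typ>\<open>gen option\<close> encodes the label $n = 0$,
  and \<^term>\<open>Some a\<close> the label $n = a$.
\<close>

definition hat :: "gen \<Rightarrow> gen option \<Rightarrow> int" where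
  "hat a n = (if n = None \<or> n = Some a then 1 else - 1)"

datatype module_type = B | AB "gen option"

fun theta :: "module_type \<Rightarrow> nat \<Rightarrow> gen \<Rightarrow> nat \<Rightarrow> int" where
  "theta B d a i = (- 1) ^ i * (int d - 2 * int i)"
| "theta (AB n) d a i = hat a n * (- 1) ^ (d + i) * (2 * int d - 2 * int i + 1)"

context vector_space
begin

definition basis_of :: "nat \<Rightarrow> (nat \<Rightarrow> 'b) \<Rightarrow> 'b set \<Rightarrow> bool" where
  "basis_of d u W \<longleftrightarrow>
    inj_on u {0..d} \<and> independent (u ` {0..d}) \<and> span (u ` {0..d}) = W"

text \<open>
  The truncated subtraction is harmless: irreducible modules are nonzero, so their finite
  dimension is positive.
\<close>

definition diameter :: nat where
  "diameter = dim UNIV - 1"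

end

locale acs_module = vector_space scale
  for scale :: "'k::field \<Rightarrow> 'v::ab_group_add \<Rightarrow> 'v" +
  fixes act :: "'k acs_alg \<Rightarrow> 'v \<Rightarrow> 'v"
  assumes act_add_right: "act p (v + w) = act p v + act p w"
    and act_add_left: "act (p + q) v = act p v + act q v"
    and act_mult: "act (p * q) v = act p (act q v)"
    and act_one: "act 1 v = v"
    and act_scalar: "act (alg_scalar c) v = scale c v"
begin

definition submodule :: "'v set \<Rightarrow> bool" where
  "submodule W \<longleftrightarrow> subspace W \<and> (\<forall>p. \<forall>w\<in>W. act p w \<in> W)"

definition irreducible_module :: bool where
  "irreducible_module \<longleftrightarrow>
    (UNIV :: 'v set) \<noteq> {0} \<and> (\<forall>W. submodule W \<longrightarrow> W = {0} \<or> W = UNIV)"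

abbreviation gen_act :: "gen \<Rightarrow> 'v \<Rightarrow> 'v" where
  "gen_act a \<equiv> act (alg_gen a)"

abbreviation iscale :: "int \<Rightarrow> 'v \<Rightarrow> 'v" where
  "iscale k \<equiv> scale (of_int k)"

text \<open>
  The standard bases are indexed by the integers, so that the boundary conventions for the
  indices $-1$ and $d + 1$ can be stated literally. For $i \ge 0$ the sign $(-1)^{i-1}$ is
  written $(-1)^{i+1}$, which keeps exponents natural.
\<close>

fun has_type :: "module_type \<Rightarrow> bool" where
  "has_type B \<longleftrightarrow> even diameter \<and>
    (\<exists>v :: int \<Rightarrow> 'v. let d = int diameter in
      basis_of diameter (\<lambda>i. v (int i)) UNIV \<and> v (- 1) = 0 \<and> v (d + 1) = 0 \<and>
      (\<forall>j\<le>diameter. let i = int j in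
        gen_act Gx (v i) = iscale ((- 1) ^ j * (d - 2 * i)) (v i) \<and>
        gen_act Gy (v i) = iscale (d - i + 1) (v (i - 1)) + iscale (i + 1) (v (i + 1)) \<and>
        gen_act Gz (v i) = iscale ((- 1) ^ (j + 1) * (d - i + 1)) (v (i - 1))
          + iscale ((- 1) ^ j * (i + 1)) (v (i + 1))))"
| "has_type (AB n) \<longleftrightarrow>
    (\<exists>v :: int \<Rightarrow> 'v. let d = int diameter in
      basis_of diameter (\<lambda>i. v (int i)) UNIV \<and> v (- 1) = 0 \<and> v (d + 1) = v d \<and>
      (\<forall>j\<le>diameter. let i = int j in
        gen_act Gx (v i) =
          iscale (hat Gx n * (- 1) ^ (diameter + j) * (2 * d - 2 * i + 1)) (v i) \<and>
        gen_act Gy (v i) = iscale (hat Gy n * (- 1) ^ diameter)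
          (iscale (2 * d - i + 2) (v (i - 1)) + iscale (i + 1) (v (i + 1))) \<and>
        gen_act Gz (v i) = iscale (hat Gz n)
          (iscale ((- 1) ^ (j + 1) * (2 * d - i + 2)) (v (i - 1))
            + iscale ((- 1) ^ j * (i + 1)) (v (i + 1)))))"

text \<open>
  A finite-dimensional irreducible module over an algebraically closed field of
  characteristic zero has exactly one type, so the choice below is then determined.
\<close>

definition type_of :: module_type where
  "type_of = (SOME t. has_type t)"

definition eigval :: "gen \<Rightarrow> nat \<Rightarrow> 'k" where
  "eigval a i = of_int (theta type_of diameter a i)"

definition eigenspace :: "gen \<Rightarrow> 'k \<Rightarrow> 'v set" where
  "eigenspace a c = {v. gen_act a v = scale c v}"

definition prim_idem :: "gen \<Rightarrow> nat \<Rightarrow> 'v \<Rightarrow> 'v" where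
  "prim_idem a i = (THE p. Vector_Spaces.linear scale scale p \<and>
    range p \<subseteq> eigenspace a (eigval a i) \<and>
    (\<forall>v \<in> eigenspace a (eigval a i). p v = v) \<and>
    (\<forall>c. c \<noteq> eigval a i \<longrightarrow> (\<forall>v \<in> eigenspace a c. p v = 0)))"

end

end

theory Submission
  imports Defs
begin

text \<open>
  For distinct $a, b, c$ among the generators put $R_\epsilon = b + \epsilon c$ with
  $\epsilon = \pm 1$. The relations give $a R_\epsilon = R_\epsilon (2\epsilon - a)$, so
  $R_\epsilon$ permutes the eigenspaces of $a$, and $R_\epsilon^2 = m - (a - \epsilon)^2$ where
  $m - 1$ is the scalar by which the central element $x^2 + y^2 + z^2$ acts. Applying $R_1$ and
  $R_{-1}$ alternately to an eigenvector of $a$ sweeps out the module. For $a = x$ this yields the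
  classification: type $AB$ occurs if $x$ has an eigenvalue $\pm 1$ (a fixed point of
  $\theta \mapsto \pm 2 - \theta$), and type $B$ otherwise. For each type the eigenvalue
  $\theta_0^a$ is realised by a signed sum of the standard basis, and the chain starting there is
  an eigenbasis $u_i$ of $a$ in which $b$ is tridiagonal. With $\theta_0^b = \pm L$, the
  coordinates $\alpha_i$ of an eigenvector of $b$ satisfy
  $\pm\alpha_i = 2 (i + 1) \alpha_{i+1}$, so none of them vanishes.
\<close>

section \<open>Modules over the algebra\<close>

text \<open>The numbers \<open>theta\<close> refer to a chosen type, so nothing is known about the
  eigenvalues in question until some type is shown to exist; hence an explicit classification
  precedes the claim about idempotents. The standard bases single out x, whereas the claim treats
  all ordered pairs of generators alike. The bridge is a description symmetric in the generators:
  signs s(a) and one number L, with L = d for type B and L = 2d + 1 for type AB, such that theta_i^a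
  = s(a) (-1)^i (L - 2i) and x^2 + y^2 + z^2 acts as (L + 1)^2 - 1. From these data an eigenbasis
  for any generator can be rebuilt without returning to the standard basis. In such a basis the
  eigenvector equation of b is a three-term recurrence, whose solutions may in general have zeros.
  For the extremal eigenvalue L or -L each equation splits off a factor L - i, nonzero for i < d,
  and a two-term recurrence remains. This is where the index 0 on the side of b matters.\<close>

lemma free_alg_induct [case_names scalar gen add mult]:
  fixes p :: "'k::field free_alg"
  assumes scalar: "\<And>c. P (free_scalar c)" and gen: "\<And>a. P (free_gen a)"
    and add: "\<And>p q. P p \<Longrightarrow> P q \<Longrightarrow> P (p + q)" and mult: "\<And>p q. P p \<Longrightarrow> P q \<Longrightarrow> P (p * q)"
  shows "P p"
proof -
  have word: "P (Poly_Mapping.single (Word l) 1)" for l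
  proof (induction l)
    case Nil
    then show ?case using scalar[of 1] by (simp add: free_scalar_def zero_word_def)
  next
    case (Cons a l)
    have "Poly_Mapping.single (Word (a # l)) (1 :: 'k) = free_gen a * Poly_Mapping.single (Word l) 1"
      by (simp add: free_gen_def mult_single plus_word_def)
    then show ?case using mult[OF gen Cons] by simp
  qed
  have single: "P (Poly_Mapping.single w c)" for w c
  proof (cases w)
    case (Word l)
    have "Poly_Mapping.single w c = free_scalar c * Poly_Mapping.single (Word l) 1"
      by (simp add: free_scalar_def mult_single Word)
    then show ?thesis using mult[OF scalar word] by simp
  qed
  show ?thesis
  proof (induction p rule: Poly_Mapping.update_induct)
    case const
    show ?case using single[of 0 0] by simp
  next
    case (update f w c)
    have "Poly_Mapping.update w c f = f + Poly_Mapping.single w c"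
      using update(1)
      by (intro poly_mapping_eqI)
        (auto simp: lookup_update lookup_add lookup_single in_keys_iff when_def)
    then show ?case using add[OF update(3) single] by simp
  qed
qed

lemma acs_alg_induct [case_names scalar gen add mult]:
  fixes p :: "'k::field acs_alg"
  assumes "\<And>c. P (alg_scalar c)" "\<And>a. P (alg_gen a)"
    "\<And>p q. P p \<Longrightarrow> P q \<Longrightarrow> P (p + q)" "\<And>p q. P p \<Longrightarrow> P q \<Longrightarrow> P (p * q)"
  shows "P p"
proof -
  have "P (abs_acs_alg r)" for r
    by (induction r rule: free_alg_induct)
      (metis assms alg_scalar.abs_eq alg_gen.abs_eq plus_acs_alg.abs_eq times_acs_alg.abs_eq)+
  then show ?thesis by (metis Quotient_acs_alg Quotient_rep_abs Quotient_abs_rep)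
qed

lemma alg_gen_scalar_commute: "alg_gen a * alg_scalar c = alg_scalar c * alg_gen a"
  by transfer (simp add: free_gen_def free_scalar_def mult_single rel_cong_def rel_ideal.zero)

context acs_module
begin

text \<open>Scalars are central in the algebra, so homogeneity follows from the module axioms, which
  do not state it.\<close>

lemma gen_act_scale: "gen_act a (scale c v) = scale c (gen_act a v)"
  by (metis act_mult act_scalar alg_gen_scalar_commute)

lemma linear_gen_act: "Vector_Spaces.linear scale scale (gen_act a)"
  by (simp add: Vector_Spaces.linear_iff vector_space_axioms act_add_right gen_act_scale)

lemma gen_act_zero [simp]: "gen_act a 0 = 0"
  using gen_act_scale[of a 0 0] by simp

lemma gen_act_sum: "gen_act a (\<Sum>i\<in>I. f i) = (\<Sum>i\<in>I. gen_act a (f i))"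
  by (induction I rule: infinite_finite_induct) (simp_all add: act_add_right)

text \<open>The defining relations form one orbit under permutations of the generators; an arbitrary
  ordering a, b, c lets later arguments treat all generators alike.\<close>

lemma gen_act_relation:
  assumes "distinct [a, b, c]"
  shows "gen_act a (gen_act b v) + gen_act b (gen_act a v) = scale 2 (gen_act c v)"
proof -
  have two: "act 2 w = scale 2 w" for w
    by (metis act_add_left act_one one_add_one scale_left_distrib scale_one)
  note r = acs_alg_relations[THEN arg_cong[where f = "\<lambda>p. act p v"],
      unfolded act_add_left act_mult two]
  show ?thesis using assms r by (cases a; cases b; cases c) (auto simp: add.commute)
qed

lemma submoduleI:
  assumes "subspace W" "\<And>a w. w \<in> W \<Longrightarrow> gen_act a w \<in> W"
  shows "submodule W"
proof -
  have "\<forall>w\<in>W. act p w \<in> W" for p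
    by (induction p rule: acs_alg_induct)
      (use assms in \<open>auto simp: act_scalar act_add_left act_mult subspace_scale subspace_add\<close>)
  then show ?thesis using assms by (auto simp: submodule_def)
qed

end

section \<open>Eigenvectors\<close>

context vector_space
begin

text \<open>\<open>independent\<close> speaks of the set of values and does not notice a repeated
  vector; a repetition would give the relation with coefficients 1 and -1.\<close>

lemma independent_familyI:
  assumes "finite I"
    and zero: "\<And>\<alpha> i. (\<Sum>i\<in>I. scale (\<alpha> i) (u i)) = 0 \<Longrightarrow> i \<in> I \<Longrightarrow> \<alpha> i = 0"
  shows "inj_on u I" "independent (u ` I)"
proof -
  show inj: "inj_on u I"
  proof (rule inj_onI, rule ccontr)
    fix i j assume ij: "i \<in> I" "j \<in> I" "u i = u j" "i \<noteq> j"
    let ?\<alpha> = "\<lambda>k. if k = i then 1 else if k = j then - 1 else 0"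
    have "(\<Sum>k\<in>I. scale (?\<alpha> k) (u k)) = (\<Sum>k\<in>{i, j}. scale (?\<alpha> k) (u k))"
      using ij \<open>finite I\<close> by (intro sum.mono_neutral_right) auto
    also have "\<dots> = 0" using ij by simp
    finally show False using zero[of ?\<alpha> i] ij(1) by simp
  qed
  show "independent (u ` I)"
  proof (rule independent_if_scalars_zero)
    fix f x assume f: "(\<Sum>x\<in>u ` I. scale (f x) x) = 0" and "x \<in> u ` I"
    then obtain i where "i \<in> I" "x = u i" by blast
    then show "f x = 0" using zero[of "f \<circ> u" i] f inj by (simp add: sum.reindex)
  qed (use \<open>finite I\<close> in simp)
qed

text \<open>Applying T and subtracting \<open>\<theta> j\<close> times the relation removes the term
  of index j and multiplies the others by nonzero differences of eigenvalues.\<close>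

lemma eigenvectors_coeffs_zero:
  assumes T: "Vector_Spaces.linear scale scale T"
    and "finite I" and "\<And>i. i \<in> I \<Longrightarrow> u i \<noteq> 0" and "\<And>i. i \<in> I \<Longrightarrow> T (u i) = scale (\<theta> i) (u i)"
    and "inj_on \<theta> I" and "(\<Sum>i\<in>I. scale (\<alpha> i) (u i)) = 0" and "i \<in> I"
  shows "\<alpha> i = 0"
  using assms(2-)
proof (induction I arbitrary: \<alpha> i rule: finite_induct)
  case (insert j F)
  interpret T: Vector_Spaces.linear scale scale T by (rule T)
  have sum: "scale (\<alpha> j) (u j) + (\<Sum>i\<in>F. scale (\<alpha> i) (u i)) = 0"
    using insert by simp
  then have "T (scale (\<alpha> j) (u j)) + (\<Sum>i\<in>F. T (scale (\<alpha> i) (u i))) = 0"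
    by (metis T.add T.sum T.zero)
  then have "scale (\<alpha> j * \<theta> j) (u j) + (\<Sum>i\<in>F. scale (\<alpha> i * \<theta> i) (u i)) = 0"
    using insert.prems(2) by (simp add: T.scale)
  moreover have "scale (\<alpha> j * \<theta> j) (u j) + (\<Sum>i\<in>F. scale (\<theta> j * \<alpha> i) (u i)) = 0"
    using arg_cong[OF sum, of "scale (\<theta> j)"]
    by (simp add: scale_right_distrib scale_sum_right mult.commute)
  ultimately have "(\<Sum>i\<in>F. scale (\<alpha> i * \<theta> i) (u i)) - (\<Sum>i\<in>F. scale (\<theta> j * \<alpha> i) (u i)) = 0"
    by (metis add_left_cancel diff_self)
  then have "(\<Sum>i\<in>F. scale (\<alpha> i * (\<theta> i - \<theta> j)) (u i)) = 0"
    by (simp add: right_diff_distrib scale_left_diff_distrib sum_subtractf mult.commute)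
  then have "\<alpha> i * (\<theta> i - \<theta> j) = 0" if "i \<in> F" for i
    using insert.IH[where \<alpha> = "\<lambda>i. \<alpha> i * (\<theta> i - \<theta> j)"] insert.prems that by simp
  moreover have "\<theta> i \<noteq> \<theta> j" if "i \<in> F" for i
    using insert.prems(3) insert.hyps(2) that by (metis inj_on_def insertCI)
  ultimately have F: "\<alpha> i = 0" if "i \<in> F" for i using that by simp
  then have "scale (\<alpha> j) (u j) = 0" using sum by simp
  then have "\<alpha> j = 0" using insert.prems(1) by simp
  then show ?case using F insert.prems(5) by blast
qed simp

lemma eigenvectors_independent:
  assumes "Vector_Spaces.linear scale scale T"
    and "finite I" and "\<And>i. i \<in> I \<Longrightarrow> u i \<noteq> 0" and "\<And>i. i \<in> I \<Longrightarrow> T (u i) = scale (\<theta> i) (u i)"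
    and "inj_on \<theta> I"
  shows "inj_on u I" "independent (u ` I)"
proof -
  have "\<alpha> i = 0" if "(\<Sum>i\<in>I. scale (\<alpha> i) (u i)) = 0" "i \<in> I" for \<alpha> i
    by (rule eigenvectors_coeffs_zero[of T I u \<theta>]) (fact assms that)+
  then show "inj_on u I" "independent (u ` I)"
    using independent_familyI[OF \<open>finite I\<close>, of u] by blast+
qed

lemma basis_of_coordinates:
  assumes "basis_of d u UNIV"
  obtains \<alpha> where "v = (\<Sum>i\<le>d. scale (\<alpha> i) (u i))"
proof -
  have "v \<in> range (\<lambda>f. \<Sum>x\<in>u ` {0..d}. scale (f x) x)"
    using assms by (simp add: basis_of_def flip: span_finite)
  then obtain f where "v = (\<Sum>x\<in>u ` {0..d}. scale (f x) x)" by blast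
  then have "v = (\<Sum>i\<le>d. scale (f (u i)) (u i))"
    using assms by (simp add: basis_of_def sum.reindex atLeast0AtMost)
  then show thesis by (rule that)
qed

lemma basis_of_coeffs_zero:
  assumes u: "basis_of d u W" and "(\<Sum>i\<le>d. scale (\<alpha> i) (u i)) = 0" and "i \<le> d"
  shows "\<alpha> i = 0"
proof -
  let ?f = "\<alpha> \<circ> inv_into {0..d} u"
  have inj: "inj_on u {0..d}" using u by (simp add: basis_of_def)
  have "(\<Sum>x\<in>u ` {0..d}. scale (?f x) x) = (\<Sum>i\<le>d. scale (\<alpha> i) (u i))"
    using inj by (simp add: sum.reindex atLeast0AtMost[symmetric])
  then have "?f (u i) = 0"
    using u assms(2,3) independentD[of "u ` {0..d}" "u ` {0..d}" ?f "u i"] by (simp add: basis_of_def)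
  then show ?thesis using inj assms(3) by simp
qed

lemma basis_of_nonzero: "basis_of d u W \<Longrightarrow> i \<le> d \<Longrightarrow> u i \<noteq> 0"
  by (metis atLeastAtMost_iff basis_of_def dependent_zero image_eqI zero_le)

lemma basis_of_dim: "basis_of d u UNIV \<Longrightarrow> dim UNIV = Suc d"
  using dim_span_eq_card_independent[of "u ` {0..d}"] by (simp add: basis_of_def card_image)

lemma basis_of_linear_eqI:
  assumes "basis_of d u UNIV" "Vector_Spaces.linear scale scale p" "Vector_Spaces.linear scale scale q"
    and "\<And>i. i \<le> d \<Longrightarrow> p (u i) = q (u i)"
  shows "p = q"
proof
  fix v
  interpret p: Vector_Spaces.linear scale scale p by fact
  interpret q: Vector_Spaces.linear scale scale q by fact
  obtain \<alpha> where "v = (\<Sum>i\<le>d. scale (\<alpha> i) (u i))" using assms(1) by (rule basis_of_coordinates)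
  then show "p v = q v" using assms(4) by (simp add: p.sum q.sum p.scale q.scale)
qed

end

context finite_dimensional_vector_space
begin

lemma eigenbasis:
  assumes "Vector_Spaces.linear scale scale T"
    and "\<And>i. i \<le> d \<Longrightarrow> u i \<noteq> 0" and "\<And>i. i \<le> d \<Longrightarrow> T (u i) = scale (\<theta> i) (u i)"
    and "inj_on \<theta> {0..d}" and "dim UNIV = Suc d"
  shows "basis_of d u UNIV"
proof -
  have "inj_on u {0..d}" "independent (u ` {0..d})"
    using eigenvectors_independent[of T "{0..d}" u \<theta>] assms by simp_all
  moreover from this have "UNIV \<subseteq> span (u ` {0..d})"
    using assms(5) by (intro card_ge_dim_independent) (simp_all add: card_image)
  ultimately show ?thesis by (auto simp: basis_of_def)
qed

text \<open>This is what makes every ladder chain stop.\<close>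

lemma eigenvector_sequence_vanishes:
  fixes u :: "nat \<Rightarrow> 'b"
  assumes "Vector_Spaces.linear scale scale T"
    and "\<And>i. T (u i) = scale (\<theta> i) (u i)" and "inj \<theta>"
  obtains i where "u i = 0"
proof (rule ccontr)
  assume "\<not> thesis"
  then have nz: "u i \<noteq> 0" for i using that by blast
  have ind: "inj_on u {..dim UNIV}" "independent (u ` {..dim UNIV})"
    using eigenvectors_independent[of T "{..dim UNIV}" u \<theta>] assms nz
    by (auto intro: inj_on_subset)
  then have "card (u ` {..dim UNIV}) \<le> dim UNIV"
    by (intro independent_card_le_dim) auto
  then show False using ind by (simp add: card_image del: dim_UNIV)
qed

end


section \<open>Existence of eigenvectors over an algebraically closed field\<close>

definition (in vector_space) poly_act :: "('b \<Rightarrow> 'b) \<Rightarrow> 'a poly \<Rightarrow> 'b \<Rightarrow> 'b" where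
  "poly_act T p v = fold_coeffs (\<lambda>c w. scale c v + T w) p 0"

context finite_dimensional_vector_space
begin

context
  fixes T assumes T: "Vector_Spaces.linear scale scale T"
begin

interpretation T: Vector_Spaces.linear scale scale T by (rule T)

lemma poly_act_0 [simp]: "poly_act T 0 v = 0"
  by (simp add: poly_act_def)

lemma poly_act_pCons [simp]: "poly_act T (pCons c p) v = scale c v + T (poly_act T p v)"
  by (cases "p = 0 \<and> c = 0") (auto simp: poly_act_def T.zero)

lemma poly_act_add: "poly_act T (p + q) v = poly_act T p v + poly_act T q v"
  by (induction p q rule: poly_induct2) (simp_all add: T.add scale_left_distrib algebra_simps)

lemma poly_act_smult: "poly_act T (smult c p) v = scale c (poly_act T p v)"
  by (induction p) (simp_all add: T.scale scale_right_distrib)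

lemma poly_act_diff: "poly_act T (p - q) v = poly_act T p v - poly_act T q v"
  using poly_act_add[of "p - q" q v] by simp

lemma poly_act_monom: "poly_act T (monom c n) v = scale c ((T ^^ n) v)"
  by (induction n) (simp_all add: monom_0 monom_Suc T.zero T.scale)

lemma poly_act_sum: "poly_act T (\<Sum>i\<in>I. p i) v = (\<Sum>i\<in>I. poly_act T (p i) v)"
  by (induction I rule: infinite_finite_induct) (simp_all add: poly_act_add)

text \<open>The dim + 1 iterates \<open>(T ^^ i) v\<close> cannot form an independent family; a
  linear relation among them is read as a polynomial.\<close>

lemma annihilating_poly:
  obtains p where "p \<noteq> 0" "poly_act T p v = 0"
proof -
  let ?u = "\<lambda>i. (T ^^ i) v" and ?I = "{..dim UNIV}"
  have "\<not> (inj_on ?u ?I \<and> independent (?u ` ?I))"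
  proof
    assume "inj_on ?u ?I \<and> independent (?u ` ?I)"
    then have "Suc (dim UNIV) \<le> dim UNIV"
      using independent_card_le_dim[of "?u ` ?I" UNIV] by (simp only: card_image card_atMost) blast
    then show False by simp
  qed
  then obtain \<alpha> i where \<alpha>: "(\<Sum>i\<in>?I. scale (\<alpha> i) (?u i)) = 0" "i \<in> ?I" "\<alpha> i \<noteq> 0"
    using independent_familyI[of ?I ?u] by blast
  let ?p = "\<Sum>i\<in>?I. monom (\<alpha> i) i"
  have "coeff ?p i = \<alpha> i"
    using \<alpha>(2) by (simp add: coeff_sum if_distrib[of "\<lambda>x. x = _"] cong: if_cong del: dim_UNIV)
  then have "?p \<noteq> 0" using \<alpha>(3) by (metis coeff_0)
  moreover have "poly_act T ?p v = 0" using \<alpha>(1) by (simp add: poly_act_sum poly_act_monom)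
  ultimately show thesis by (rule that)
qed

end

end

text \<open>Split a root r off a polynomial p with p(T) v = 0. With q the cofactor, q(T) v is an
  eigenvector for r unless it is zero, and then q is an annihilating polynomial of smaller degree. A
  nonzero constant cannot annihilate v, so the descent meets an eigenvector.\<close>

lemma eigenvector_exists:
  fixes scale :: "'k::alg_closed_field \<Rightarrow> 'v::ab_group_add \<Rightarrow> 'v" and v :: 'v
  assumes "finite_dimensional_vector_space scale Basis"
    and T: "Vector_Spaces.linear scale scale T" and "v \<noteq> 0"
  obtains c w where "w \<noteq> 0" "T w = scale c w"
proof -
  interpret finite_dimensional_vector_space scale Basis by fact
  interpret T: Vector_Spaces.linear scale scale T by (rule T)
  have "\<exists>c w. w \<noteq> 0 \<and> T w = scale c w" if "p \<noteq> 0" "poly_act T p v = 0" for p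
    using that
  proof (induction "degree p" arbitrary: p)
    case 0
    then obtain c where "p = [:c:]" by (metis degree_eq_zeroE)
    then show ?case using 0 \<open>v \<noteq> 0\<close> by (simp add: T)
  next
    case (Suc n)
    then obtain r where "poly p r = 0"
      using alg_closed_imp_poly_has_root[of p] by auto
    then obtain q where q: "p = [:- r, 1:] * q" by (auto simp: poly_eq_0_iff_dvd dvd_def)
    then have "q \<noteq> 0" using Suc.prems(1) by auto
    have "poly_act T p v = T (poly_act T q v) - scale r (poly_act T q v)"
      by (simp add: q T poly_act_diff poly_act_smult)
    then have "T (poly_act T q v) = scale r (poly_act T q v)" using Suc.prems(2) by simp
    moreover have "degree q = n"
      using Suc.hyps(2) \<open>q \<noteq> 0\<close> by (simp add: q degree_mult_eq del: mult_pCons_left)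
    ultimately show ?case using Suc.hyps(1)[of q] \<open>q \<noteq> 0\<close> by blast
  qed
  moreover obtain p where "p \<noteq> 0" "poly_act T p v = 0"
    using annihilating_poly[OF T] .
  ultimately show thesis using that by blast
qed

section \<open>Ladder operators\<close>

locale irreducible_acs_module = acs_module scale act + finite_dimensional_vector_space scale Basis
  for scale :: "'k::{alg_closed_field, field_char_0} \<Rightarrow> 'v::ab_group_add \<Rightarrow> 'v"
    and act :: "'k acs_alg \<Rightarrow> 'v \<Rightarrow> 'v" and Basis +
  assumes irreducible: irreducible_module
begin

lemma submodule_eq_UNIV: "submodule W \<Longrightarrow> w \<in> W \<Longrightarrow> w \<noteq> 0 \<Longrightarrow> W = UNIV"
  using irreducible by (auto simp: irreducible_module_def)

lemma nonzero_vector_exists: "\<exists>v :: 'v. v \<noteq> 0"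
  using irreducible by (auto simp: irreducible_module_def)

lemma gen_act_diff: "gen_act a (v - w) = gen_act a v - gen_act a w"
  by (metis act_add_right add_diff_cancel_right' diff_add_cancel)

lemma gen_act_swap:
  assumes "distinct [a, b, c]"
  shows "gen_act a (gen_act b v) = scale 2 (gen_act c v) - gen_act b (gen_act a v)"
  using gen_act_relation[OF assms, of v] by (simp add: eq_diff_eq)

definition casimir :: "'v \<Rightarrow> 'v" where
  "casimir v = gen_act Gx (gen_act Gx v) + gen_act Gy (gen_act Gy v) + gen_act Gz (gen_act Gz v)"

lemma casimir_eq:
  assumes "distinct [a, b, c]"
  shows "casimir v = gen_act a (gen_act a v) + gen_act b (gen_act b v) + gen_act c (gen_act c v)"
  using assms by (cases a; cases b; cases c) (auto simp: casimir_def algebra_simps)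

lemma distinct_gens_exist:
  obtains b c :: gen where "distinct [a, b, c]"
  by (cases a) (auto intro: that[of Gy Gz] that[of Gx Gz] that[of Gx Gy])

text \<open>Moving a through b twice gives a b^2 = b^2 a + 2 (c b - b c); exchanging b and c gives
  the opposite correction, so a commutes with b^2 + c^2.\<close>

lemma casimir_commute: "casimir (gen_act a v) = gen_act a (casimir v)"
proof -
  obtain b c where abc: "distinct [a, b, c]" by (rule distinct_gens_exist)
  from abc have acb: "distinct [a, c, b]" by auto
  have "gen_act a (gen_act b (gen_act b v)) + gen_act a (gen_act c (gen_act c v))
      = gen_act b (gen_act b (gen_act a v)) + gen_act c (gen_act c (gen_act a v))"
    by (simp add: gen_act_swap[OF abc] gen_act_swap[OF acb] gen_act_diff gen_act_scale)
  then show ?thesis by (simp add: casimir_eq[OF abc] act_add_right algebra_simps)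
qed

lemma linear_casimir: "Vector_Spaces.linear scale scale casimir"
  by (simp add: Vector_Spaces.linear_iff vector_space_axioms casimir_def act_add_right
      gen_act_scale scale_right_distrib algebra_simps)

text \<open>The shift by one turns the ladder operators into square roots of a difference of squares.\<close>

definition casimir_level :: "'k \<Rightarrow> bool" where
  "casimir_level m \<longleftrightarrow> (\<forall>v. casimir v = scale (m - 1) v)"

text \<open>Schur's lemma in elementary form: an eigenspace of an operator commuting with the action
  is a submodule.\<close>

lemma casimir_levelI:
  assumes "casimir v = scale (m - 1) v" "v \<noteq> 0"
  shows "casimir_level m"
proof -
  interpret C: Vector_Spaces.linear scale scale casimir by (rule linear_casimir)
  let ?W = "{v. casimir v = scale (m - 1) v}"
  have "subspace ?W"
    by (rule subspaceI)
      (simp_all add: C.zero C.add C.scale scale_right_distrib mult.commute)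
  then have "submodule ?W"
    by (rule submoduleI) (simp add: casimir_commute gen_act_scale)
  then have "?W = UNIV" using assms by (intro submodule_eq_UNIV[of ?W v]) simp_all
  then show ?thesis by (auto simp: casimir_level_def)
qed

lemma gen_eigenvector_exists:
  obtains c v where "v \<noteq> 0" "gen_act a v = scale c v"
  using eigenvector_exists[OF finite_dimensional_vector_space_axioms linear_gen_act]
    nonzero_vector_exists by metis

lemma casimir_level_exists:
  obtains m where "casimir_level m"
proof -
  obtain v :: 'v where "v \<noteq> 0" using nonzero_vector_exists by blast
  then obtain c w where "w \<noteq> 0" "casimir w = scale c w"
    using eigenvector_exists[OF finite_dimensional_vector_space_axioms linear_casimir] by metis
  then show thesis using casimir_levelI[of w "c + 1"] by (intro that[of "c + 1"]) simp
qed

definition ladder :: "gen \<Rightarrow> gen \<Rightarrow> 'k \<Rightarrow> 'v \<Rightarrow> 'v" where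
  "ladder b c \<epsilon> v = gen_act b v + scale \<epsilon> (gen_act c v)"

lemma ladder_zero [simp]: "ladder b c \<epsilon> 0 = 0"
  by (simp add: ladder_def)

lemma ladder_add: "ladder b c \<epsilon> (v + w) = ladder b c \<epsilon> v + ladder b c \<epsilon> w"
  by (simp add: ladder_def act_add_right scale_right_distrib)

lemma ladder_scale: "ladder b c \<epsilon> (scale k v) = scale k (ladder b c \<epsilon> v)"
  by (simp add: ladder_def gen_act_scale scale_right_distrib mult.commute)

lemma ladder_eigen:
  assumes "distinct [a, b, c]" and "\<epsilon> * \<epsilon> = 1" and "gen_act a v = scale \<theta> v"
  shows "gen_act a (ladder b c \<epsilon> v) = scale (2 * \<epsilon> - \<theta>) (ladder b c \<epsilon> v)"
proof -
  from assms(1) have acb: "distinct [a, c, b]" by auto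
  have "gen_act a (ladder b c \<epsilon> v)
      = scale 2 (gen_act c v) - scale \<theta> (gen_act b v)
        + scale \<epsilon> (scale 2 (gen_act b v) - scale \<theta> (gen_act c v))"
    using assms(3) by (simp add: ladder_def act_add_right gen_act_scale
        gen_act_swap[OF assms(1)] gen_act_swap[OF acb])
  also have "\<dots> = scale (2 * \<epsilon> - \<theta>) (gen_act b v) + scale (2 * (\<epsilon> * \<epsilon>) - \<theta> * \<epsilon>) (gen_act c v)"
    using assms(2) by (simp add: scale_right_diff_distrib scale_left_diff_distrib mult.commute)
  also have "\<dots> = scale (2 * \<epsilon> - \<theta>) (ladder b c \<epsilon> v)"
    by (simp add: ladder_def scale_right_distrib left_diff_distrib mult.assoc)
  finally show ?thesis .
qed

text \<open>In the square the mixed term b c + c b equals 2 a by the relations, and b^2 + c^2 is the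
  Casimir operator minus a^2, so only a is left.\<close>

lemma ladder_ladder:
  assumes abc: "distinct [a, b, c]" and "\<epsilon> * \<epsilon> = 1" and "gen_act a v = scale \<theta> v"
    and "casimir_level m"
  shows "ladder b c \<epsilon> (ladder b c \<epsilon> v) = scale (m - (\<theta> - \<epsilon>)\<^sup>2) v"
proof -
  from abc have bca: "distinct [b, c, a]" by auto
  have "ladder b c \<epsilon> (ladder b c \<epsilon> v) = gen_act b (gen_act b v) + gen_act c (gen_act c v)
      + scale \<epsilon> (gen_act b (gen_act c v) + gen_act c (gen_act b v))"
    using assms(2) by (simp add: ladder_def act_add_right gen_act_scale scale_right_distrib)
  also have "\<dots> = casimir v - gen_act a (gen_act a v) + scale \<epsilon> (scale 2 (gen_act a v))"
    using gen_act_relation[OF bca, of v] by (simp only: casimir_eq[OF abc]) (simp add: algebra_simps)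
  also have "\<dots> = scale (m - 1 - \<theta> * \<theta> + 2 * \<epsilon> * \<theta>) v"
    using assms(3,4)
    by (simp add: casimir_level_def gen_act_scale scale_left_diff_distrib scale_left_distrib mult_ac)
  also have "m - 1 - \<theta> * \<theta> + 2 * \<epsilon> * \<theta> = m - (\<theta> - \<epsilon>)\<^sup>2"
    using assms(2) by (simp add: power2_eq_square algebra_simps)
  finally show ?thesis .
qed

text \<open>Whatever is stable under both ladder operators is therefore stable under b and
  c.\<close>

lemma gen_act_ladder:
  assumes "\<epsilon> * \<epsilon> = 1"
  shows "gen_act b v = scale (1 / 2) (ladder b c \<epsilon> v + ladder b c (- \<epsilon>) v)"
    and "gen_act c v = scale (\<epsilon> / 2) (ladder b c \<epsilon> v - ladder b c (- \<epsilon>) v)"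
proof -
  have half: "scale (1 / 2) (w + w) = w" for w
    by (simp add: scale_right_distrib flip: scale_left_distrib)
  show "gen_act b v = scale (1 / 2) (ladder b c \<epsilon> v + ladder b c (- \<epsilon>) v)"
    using half by (simp add: ladder_def algebra_simps)
  have "scale (\<epsilon> / 2) (ladder b c \<epsilon> v - ladder b c (- \<epsilon>) v)
      = scale (\<epsilon> / 2) (scale \<epsilon> (gen_act c v) + scale \<epsilon> (gen_act c v))"
    by (simp add: ladder_def)
  also have "\<dots> = scale (1 / 2) (gen_act c v + gen_act c v)"
    using assms by (simp add: scale_right_distrib)
  finally show "gen_act c v = scale (\<epsilon> / 2) (ladder b c \<epsilon> v - ladder b c (- \<epsilon>) v)"
    using half by simp
qed

end

section \<open>Chains of eigenvectors produced by alternating ladder operators\<close>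

locale ladder_chain = irreducible_acs_module scale act Basis
  for scale :: "'k::{alg_closed_field, field_char_0} \<Rightarrow> 'v::ab_group_add \<Rightarrow> 'v"
    and act :: "'k acs_alg \<Rightarrow> 'v \<Rightarrow> 'v" and Basis +
  fixes a b c :: gen and \<sigma> \<kappa> m :: 'k and v\<^sub>0 :: 'v
  assumes abc: "distinct [a, b, c]" and sign: "\<sigma> * \<sigma> = 1"
    and level: "casimir_level m"
    and start: "gen_act a v\<^sub>0 = scale (\<sigma> * \<kappa>) v\<^sub>0" and start_nonzero: "v\<^sub>0 \<noteq> 0"
begin

text \<open>Both the sign of the ladder operator leaving position i and the sign in the eigenvalue
  at position i.\<close>

definition \<epsilon> :: "nat \<Rightarrow> 'k" where "\<epsilon> i = \<sigma> * (- 1) ^ i"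

lemma \<epsilon>_square: "\<epsilon> i * \<epsilon> i = 1"
proof -
  have "\<epsilon> i * \<epsilon> i = (\<sigma> * \<sigma>) * ((- 1) * (- 1)) ^ i"
    unfolding \<epsilon>_def power_mult_distrib by (simp only: mult_ac)
  then show ?thesis using sign by simp
qed

lemma \<epsilon>_Suc: "\<epsilon> (Suc i) = - \<epsilon> i"
  by (simp add: \<epsilon>_def)

primrec u :: "nat \<Rightarrow> 'v" where
  "u 0 = v\<^sub>0"
| "u (Suc i) = ladder b c (\<epsilon> i) (u i)"

lemma u_eigen: "gen_act a (u i) = scale (\<epsilon> i * (\<kappa> - 2 * of_nat i)) (u i)"
proof (induction i)
  case 0
  then show ?case by (simp add: start \<epsilon>_def)
next
  case (Suc i)
  show ?case
    using ladder_eigen[OF abc \<epsilon>_square Suc] by (simp add: \<epsilon>_Suc algebra_simps)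
qed

text \<open>The operator leading from position i to i + 1 also leads back, up to a scalar. At the
  end of a chain this scalar must vanish, which later fixes m or \<open>\<kappa>\<close>.\<close>

lemma u_down: "ladder b c (\<epsilon> i) (u (Suc i)) = scale (m - (\<kappa> - 2 * of_nat i - 1)\<^sup>2) (u i)"
proof -
  have "(\<epsilon> i * (\<kappa> - 2 * of_nat i) - \<epsilon> i)\<^sup>2 = (\<epsilon> i * \<epsilon> i) * (\<kappa> - 2 * of_nat i - 1)\<^sup>2"
    by (simp add: power2_eq_square algebra_simps)
  then show ?thesis
    using ladder_ladder[OF abc \<epsilon>_square u_eigen level, of i] by (simp add: \<epsilon>_square)
qed

text \<open>Equal signs would give i = j. With opposite signs the two positions lie symmetrically
  about \<open>\<kappa>\<close> / 2.\<close>

lemma eigenvalue_eqD: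
  assumes eq: "\<epsilon> i * (\<kappa> - 2 * of_nat i) = \<epsilon> j * (\<kappa> - 2 * of_nat j)" and "i \<noteq> j"
  shows "odd (i + j)" "\<kappa> = of_nat (i + j)"
proof -
  have nz: "\<epsilon> i \<noteq> 0" using \<epsilon>_square[of i] by auto
  have \<epsilon>_j: "\<epsilon> j = (if odd (i + j) then - \<epsilon> i else \<epsilon> i)"
    by (auto simp: \<epsilon>_def minus_one_power_iff)
  show odd: "odd (i + j)"
  proof
    assume "even (i + j)"
    then have "\<epsilon> j = \<epsilon> i" using \<epsilon>_j by simp
    from eq[unfolded this mult_left_cancel[OF nz]]
    have "\<kappa> - 2 * of_nat i = \<kappa> - 2 * of_nat j" .
    then show False using \<open>i \<noteq> j\<close> by simp
  qed
  then have "\<epsilon> j = - \<epsilon> i" using \<epsilon>_j by simp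
  from eq[unfolded this minus_mult_commute mult_left_cancel[OF nz]]
  have "\<kappa> - 2 * of_nat i = - (\<kappa> - 2 * of_nat j)" .
  then have "2 * \<kappa> = 2 * of_nat (i + j)" by (simp add: algebra_simps)
  then show "\<kappa> = of_nat (i + j)" by (metis mult_cancel_left zero_neq_numeral)
qed

lemma eigenvalues_inj:
  assumes "\<And>i j. i < j \<Longrightarrow> j \<le> k \<Longrightarrow> odd (i + j) \<Longrightarrow> \<kappa> \<noteq> of_nat (i + j)"
  shows "inj_on (\<lambda>i. \<epsilon> i * (\<kappa> - 2 * of_nat i)) {0..k}"
proof (rule inj_onI, rule ccontr)
  fix i j assume ij: "i \<in> {0..k}" "j \<in> {0..k}" "i \<noteq> j"
    "\<epsilon> i * (\<kappa> - 2 * of_nat i) = \<epsilon> j * (\<kappa> - 2 * of_nat j)"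
  from eigenvalue_eqD[OF ij(4,3)] show False
    using assms[of i j] assms[of j i] ij(1-3)
    by (cases i j rule: linorder_cases) (simp_all add: add.commute)
qed

lemma last_nonzero:
  obtains k where "\<And>i. i \<le> k \<Longrightarrow> u i \<noteq> 0" "u (Suc k) = 0"
proof -
  \<comment> \<open>Eigenvalues at positions of different parity may coincide. At even positions the
    sign is constant, and the eigenvalues \<open>\<sigma> * (\<kappa> - 4 * of_nat i)\<close> are
    distinct.\<close>
  have "\<exists>i. u (2 * i) = 0"
  proof (rule eigenvector_sequence_vanishes[OF linear_gen_act[of a]])
    show "gen_act a (u (2 * i)) = scale (\<epsilon> (2 * i) * (\<kappa> - 2 * of_nat (2 * i))) (u (2 * i))" for i
      by (rule u_eigen)
    have "\<sigma> \<noteq> 0" using sign by auto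
    then show "inj (\<lambda>i. \<epsilon> (2 * i) * (\<kappa> - 2 * of_nat (2 * i)))"
      by (auto intro!: injI simp: \<epsilon>_def)
  qed blast
  then have ex: "\<exists>i. u i = 0" by blast
  define n where "n = (LEAST i. u i = 0)"
  have "u n = 0" unfolding n_def using ex by (rule LeastI_ex)
  moreover have "u i \<noteq> 0" if "i < n" for i using that not_less_Least unfolding n_def by blast
  moreover have "n \<noteq> 0" using \<open>u n = 0\<close> start_nonzero by (metis u.simps(1))
  ultimately show thesis using that[of "n - 1"] by (metis Suc_pred' le_imp_less_Suc not_gr_zero)
qed

text \<open>Inside the chain one ladder operator moves forward and the other back, so only the two
  ends could leave the span, and the hypotheses control these. Membership rather than vanishing is
  asked for because in type AB the lower end returns a multiple of the start.\<close>

lemma u_span: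
  assumes "ladder b c (- \<sigma>) v\<^sub>0 \<in> span (u ` {0..k})" and "u (Suc k) \<in> span (u ` {0..k})"
  shows "span (u ` {0..k}) = UNIV"
proof -
  let ?S = "span (u ` {0..k})"
  have base: "gen_act g (u i) \<in> ?S" if "i \<le> k" for g i
  proof -
    have up: "ladder b c (\<epsilon> i) (u i) \<in> ?S"
    proof (cases "i = k")
      case True
      then show ?thesis using assms(2) by simp
    next
      case False
      then have "u (Suc i) \<in> ?S" using that by (intro span_base imageI) simp
      then show ?thesis by simp
    qed
    have down: "ladder b c (- \<epsilon> i) (u i) \<in> ?S"
    proof (cases i)
      case 0
      then show ?thesis using assms(1) by (simp add: \<epsilon>_def)
    next
      case (Suc j)
      have "ladder b c (\<epsilon> j) (u (Suc j)) \<in> ?S"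
        unfolding u_down using that Suc by (intro span_scale span_base) auto
      then show ?thesis by (simp only: Suc \<epsilon>_Suc minus_minus)
    qed
    have "gen_act a (u i) \<in> ?S"
      unfolding u_eigen using that by (intro span_scale span_base) auto
    moreover have "gen_act b (u i) \<in> ?S"
      by (subst gen_act_ladder(1)[OF \<epsilon>_square[of i], where b = b and c = c]) (intro span_scale span_add up down)
    moreover have "gen_act c (u i) \<in> ?S"
      by (subst gen_act_ladder(2)[OF \<epsilon>_square[of i], where b = b and c = c]) (intro span_scale span_diff up down)
    moreover have "g = a \<or> g = b \<or> g = c" using abc by (cases g; cases a; cases b; cases c) auto
    ultimately show ?thesis by blast
  qed
  have "gen_act g w \<in> ?S" if "w \<in> ?S" for g w
    using that
  proof (induction rule: span_induct)
    case base
    show ?case by (rule subspaceI) (auto simp: act_add_right gen_act_scale span_zero intro: span_add span_scale)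
  next
    case (step x)
    then show ?case using base by auto
  qed
  then have "submodule ?S" by (intro submoduleI) auto
  moreover have "v\<^sub>0 \<in> ?S" by (rule span_base) (auto intro: image_eqI[of _ _ 0])
  ultimately show ?thesis using start_nonzero by (rule submodule_eq_UNIV)
qed

lemma u_basis:
  assumes "ladder b c (- \<sigma>) v\<^sub>0 \<in> span (u ` {0..k})" and "u (Suc k) = 0"
    and "\<And>i. i \<le> k \<Longrightarrow> u i \<noteq> 0"
    and "\<And>i j. i < j \<Longrightarrow> j \<le> k \<Longrightarrow> odd (i + j) \<Longrightarrow> \<kappa> \<noteq> of_nat (i + j)"
  shows "basis_of k u UNIV" "diameter = k"
proof -
  have "span (u ` {0..k}) = UNIV" using u_span[of k] assms(1,2) span_zero by simp
  moreover have "inj_on u {0..k}" "independent (u ` {0..k})"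
    using eigenvectors_independent[OF linear_gen_act[of a], of "{0..k}" u, OF _ _ u_eigen
        eigenvalues_inj[of k, OF assms(4)]] assms(3) by simp_all
  ultimately show basis: "basis_of k u UNIV" by (simp add: basis_of_def)
  show "diameter = k" using basis_of_dim[OF basis] by (simp add: diameter_def)
qed

lemma act_b_u_0: "gen_act b (u 0) = scale (1 / 2) (u 1 + ladder b c (- \<sigma>) v\<^sub>0)"
  using gen_act_ladder(1)[OF \<epsilon>_square[of 0], where b = b and c = c and v = "u 0"]
  by (simp add: \<epsilon>_def)

lemma act_b_u_Suc: "gen_act b (u (Suc i)) =
    scale (1 / 2) (u (Suc (Suc i)) + scale (m - (\<kappa> - 2 * of_nat i - 1)\<^sup>2) (u i))"
  using gen_act_ladder(1)[OF \<epsilon>_square[of "Suc i"], where b = b and c = c and v = "u (Suc i)"]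
    u_down[of i] by (simp add: \<epsilon>_Suc)

lemma act_c_u_0: "gen_act c (u 0) = scale (\<sigma> / 2) (u 1 - ladder b c (- \<sigma>) v\<^sub>0)"
  using gen_act_ladder(2)[OF \<epsilon>_square[of 0], where b = b and c = c and v = "u 0"]
  by (simp add: \<epsilon>_def)

lemma act_c_u_Suc: "gen_act c (u (Suc i)) =
    scale (\<epsilon> (Suc i) / 2) (u (Suc (Suc i)) - scale (m - (\<kappa> - 2 * of_nat i - 1)\<^sup>2) (u i))"
  using gen_act_ladder(2)[OF \<epsilon>_square[of "Suc i"], where b = b and c = c and v = "u (Suc i)"]
    u_down[of i] by (simp add: \<epsilon>_Suc)

end

section \<open>Classification\<close>

context irreducible_acs_module
begin

text \<open>Three chains are run. One from an arbitrary eigenvector ends in a vector killed by a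
  ladder operator; one from that vector is closed at both ends, which forces \<open>\<kappa>\<close>
  to be the index k of its last vector; one from the end with eigenvalue k yields the standard
  basis.\<close>

lemma type_B:
  assumes no_unit: "\<And>v \<rho>. v \<noteq> 0 \<Longrightarrow> \<rho> * \<rho> = 1 \<Longrightarrow> gen_act Gx v \<noteq> scale \<rho> v"
  shows "has_type B"
proof -
  obtain m where m: "casimir_level m" by (rule casimir_level_exists)
  have abc: "distinct [Gx, Gy, Gz]" by simp
  obtain \<delta> \<theta> v where v: "\<delta> * \<delta> = 1" "v \<noteq> 0" "gen_act Gx v = scale \<theta> v" "ladder Gy Gz \<delta> v = 0"
  proof -
    obtain \<theta>\<^sub>0 w where w: "w \<noteq> 0" "gen_act Gx w = scale \<theta>\<^sub>0 w" by (rule gen_eigenvector_exists)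
    interpret C: ladder_chain scale act Basis Gx Gy Gz 1 \<theta>\<^sub>0 m w
      by unfold_locales (use m w in auto)
    obtain k where k: "\<And>i. i \<le> k \<Longrightarrow> C.u i \<noteq> 0" "C.u (Suc k) = 0" by (rule C.last_nonzero) blast
    show thesis using that[OF C.\<epsilon>_square k(1)[of k] C.u_eigen] k(2) by simp
  qed
  have "\<exists>k v. even k \<and> v \<noteq> 0 \<and> gen_act Gx v = scale (of_nat k) v \<and> ladder Gy Gz (- 1) v = 0
    \<and> m = (of_nat k + 1)\<^sup>2"
  proof -
    \<comment> \<open>The sign opposite to \<open>\<delta>\<close> makes the chain leave v by the
      other ladder operator than the one known to kill v.\<close>
    define \<sigma> \<kappa> where "\<sigma> = - \<delta>" and "\<kappa> = - \<delta> * \<theta>"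
    have \<sigma>: "\<sigma> * \<sigma> = 1" "\<sigma> * \<kappa> = \<theta>" using v(1) by (simp_all add: \<sigma>_def \<kappa>_def flip: mult.assoc)
    interpret C: ladder_chain scale act Basis Gx Gy Gz \<sigma> \<kappa> m v
      by unfold_locales (use m v \<sigma> in auto)
    obtain k where k: "\<And>i. i \<le> k \<Longrightarrow> C.u i \<noteq> 0" "C.u (Suc k) = 0" by (rule C.last_nonzero) blast
    \<comment> \<open>Each closed end gives an equation for m; the difference of the two factors and
      leaves \<open>\<kappa>\<close> = k.\<close>
    have "scale (m - (\<theta> - \<delta>)\<^sup>2) v = 0"
      using ladder_ladder[OF abc v(1,3) m] by (simp add: v(4))
    moreover have "(\<theta> - \<delta>)\<^sup>2 = (\<sigma> * \<sigma>) * (\<kappa> + 1)\<^sup>2"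
      unfolding \<sigma>(2)[symmetric] by (simp add: \<sigma>_def power2_eq_square algebra_simps)
    ultimately have m_eq: "m = (\<kappa> + 1)\<^sup>2" using v(2) \<sigma> by simp
    have "m = (\<kappa> - 2 * of_nat k - 1)\<^sup>2"
      using C.u_down[of k] k by (simp del: C.u.simps)
    moreover have "(\<kappa> + 1)\<^sup>2 - (\<kappa> - 2 * of_nat k - 1)\<^sup>2 = 4 * ((of_nat k + 1) * (\<kappa> - of_nat k))"
      by (simp add: power2_eq_square algebra_simps)
    ultimately have "(of_nat k + 1) * (\<kappa> - of_nat k) = 0" by (simp add: m_eq)
    moreover have "(of_nat k + 1 :: 'k) \<noteq> 0" by (metis of_nat_Suc of_nat_neq_0 add.commute)
    ultimately have \<kappa>: "\<kappa> = of_nat k" by simp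
    \<comment> \<open>For odd k the position (k - 1) / 2 would have eigenvalue 1 or -1, contrary to
      \<open>no_unit\<close>.\<close>
    have "even k"
    proof (rule ccontr)
      assume "odd k"
      then obtain j where j: "k = 2 * j + 1" by (metis oddE)
      then have "gen_act Gx (C.u j) = scale (C.\<epsilon> j) (C.u j)" using C.u_eigen[of j] \<kappa> by simp
      then show False using no_unit[OF k(1)[of j] C.\<epsilon>_square] j by simp
    qed
    show ?thesis
    proof (cases "\<sigma> = 1")
      case True
      then have "\<delta> = - 1" by (metis \<sigma>_def minus_minus)
      then show ?thesis
        using v True \<sigma> \<kappa> \<open>even k\<close> m_eq by (intro exI[of _ k] exI[of _ v]) simp
    next
      \<comment> \<open>In this orientation the ends exchange roles: k being even, the last vector
        has eigenvalue k and is killed by the ladder operator of sign -1.\<close>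
      case False
      then have "\<sigma> = - 1" using \<sigma>(1) by (metis square_eq_1_iff)
      moreover have "gen_act Gx (C.u k) = scale (- \<sigma> * of_nat k) (C.u k)"
        using C.u_eigen[of k] \<open>even k\<close> \<kappa> by (simp add: C.\<epsilon>_def)
      moreover have "ladder Gy Gz \<sigma> (C.u k) = 0"
        using k(2) \<open>even k\<close> by (simp add: C.\<epsilon>_def)
      ultimately show ?thesis
        using k(1)[of k] \<kappa> \<open>even k\<close> m_eq by (intro exI[of _ k] exI[of _ "C.u k"]) simp
    qed
  qed
  then obtain k w where even: "even k" and w: "w \<noteq> 0" "gen_act Gx w = scale (of_nat k) w"
    "ladder Gy Gz (- 1) w = 0" and m_eq: "m = (of_nat k + 1)\<^sup>2" by blast
  interpret C: ladder_chain scale act Basis Gx Gy Gz 1 "of_nat k" m w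
    by unfold_locales (use m w in auto)
  obtain l where l: "\<And>i. i \<le> l \<Longrightarrow> C.u i \<noteq> 0" "C.u (Suc l) = 0" by (rule C.last_nonzero) blast
  have down: "m - (of_nat k - 2 * of_nat i - 1)\<^sup>2 = 4 * (of_nat i + 1) * (of_nat k - of_nat i)" for i
    unfolding m_eq by (simp add: power2_eq_square algebra_simps)
  have pos: "(of_nat i + 1 :: 'k) \<noteq> 0" for i by (metis of_nat_Suc of_nat_neq_0 add.commute)
  have "4 * (of_nat l + 1) * (of_nat k - of_nat l :: 'k) = 0"
    using C.u_down[of l] l by (simp add: down del: C.u.simps)
  then have "l = k"
    using pos[of l] by (metis mult_eq_0_iff of_nat_eq_iff right_minus_eq zero_neq_numeral)
  note l = l[unfolded \<open>l = k\<close>]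
  have ne: "of_nat k \<noteq> (of_nat (i + j) :: 'k)" if "odd (i + j)" for i j
    using even that by (metis of_nat_eq_iff)
  have basis: "basis_of k C.u UNIV" "diameter = k"
    using C.u_basis[of k] l ne w(3) span_zero by simp_all
  \<comment> \<open>Chosen to turn the forward coefficient 1/2 of the chain into the coefficient i +
    1 of the standard basis.\<close>
  define \<beta> :: "nat \<Rightarrow> 'k" where "\<beta> n = 1 / (2 ^ n * fact n)" for n
  have \<beta>_Suc: "\<beta> n = 2 * (of_nat n + 1) * \<beta> (Suc n)" for n
  proof -
    have "\<beta> (Suc n) = \<beta> n / (2 * (of_nat n + 1))" by (simp add: \<beta>_def mult_ac add.commute)
    moreover have "2 * (of_nat n + 1 :: 'k) \<noteq> 0" using pos[of n] by (metis mult_eq_0_iff zero_neq_numeral)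
    ultimately show ?thesis by (metis nonzero_mult_div_cancel_left times_divide_eq_right)
  qed
  have \<beta>_nz: "\<beta> n \<noteq> 0" for n by (simp add: \<beta>_def)
  define V where "V i = (if i < 0 then 0 else scale (\<beta> (nat i)) (C.u (nat i)))" for i
  have V_int: "V (int n) = scale (\<beta> n) (C.u n)" for n by (simp add: V_def)
  have V_Suc: "V (int n + 1) = scale (\<beta> (Suc n)) (C.u (Suc n))" for n
    using V_int[of "Suc n"] by (simp add: add.commute)
  have eigen: "gen_act Gx (V (int j)) = scale ((- 1) ^ j * (of_nat k - 2 * of_nat j)) (V (int j))" for j
    using C.u_eigen[of j] by (simp add: V_int gen_act_scale C.\<epsilon>_def mult.commute)
  have "basis_of k (\<lambda>i. V (int i)) UNIV"
  proof (rule eigenbasis[OF linear_gen_act[of Gx] _ eigen])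
    show "V (int i) \<noteq> 0" if "i \<le> k" for i using l(1)[OF that] by (simp add: V_int \<beta>_nz)
    show "inj_on (\<lambda>i. (- 1) ^ i * (of_nat k - 2 * of_nat i) :: 'k) {0..k}"
      using C.eigenvalues_inj[of k, OF ne] by (simp add: C.\<epsilon>_def)
    show "dim UNIV = Suc k" by (rule basis_of_dim[OF basis(1)])
  qed
  moreover have "V (int k + 1) = 0" unfolding V_Suc l(2) by simp
  moreover have "gen_act Gy (V (int j)) = scale (of_nat k - of_nat j + 1) (V (int j - 1))
      + scale (of_nat j + 1) (V (int j + 1))" for j
  proof (cases j)
    case 0
    then show ?thesis
      using C.act_b_u_0 w(3) by (simp add: V_Suc[of 0, simplified] V_def \<beta>_def)
  next
    case (Suc i)
    have V_pred: "V (int j - 1) = scale (\<beta> i) (C.u i)" by (simp add: Suc V_int)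
    have act: "gen_act Gy (V (int j)) = scale (\<beta> j * (1 / 2)) (C.u (Suc j))
        + scale (\<beta> j * (1 / 2 * (4 * (of_nat i + 1) * (of_nat k - of_nat i)))) (C.u i)"
      by (simp only: V_int gen_act_scale Suc C.act_b_u_Suc down scale_right_distrib scale_scale mult.assoc)
    have c1: "\<beta> j * (1 / 2) = (of_nat j + 1) * \<beta> (Suc j)" using \<beta>_Suc[of j] by simp
    have c2: "\<beta> j * (1 / 2 * (4 * (of_nat i + 1) * (of_nat k - of_nat i)))
      = (of_nat k - of_nat j + 1) * \<beta> i"
      using \<beta>_Suc[of i] by (simp add: Suc)
    show ?thesis
      unfolding act c1 c2 V_pred V_Suc by (simp add: add.commute del: C.u.simps of_nat_Suc)
  qed
  moreover have "gen_act Gz (V (int j)) = scale ((- 1) ^ (j + 1) * (of_nat k - of_nat j + 1)) (V (int j - 1))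
      + scale ((- 1) ^ j * (of_nat j + 1)) (V (int j + 1))" for j
  proof (cases j)
    case 0
    then show ?thesis
      using C.act_c_u_0 w(3) by (simp add: V_Suc[of 0, simplified] V_def \<beta>_def)
  next
    case (Suc i)
    have V_pred: "V (int j - 1) = scale (\<beta> i) (C.u i)" by (simp add: Suc V_int)
    have act: "gen_act Gz (V (int j)) = scale (\<beta> j * (C.\<epsilon> j / 2)) (C.u (Suc j))
        - scale (\<beta> j * (C.\<epsilon> j / 2 * (4 * (of_nat i + 1) * (of_nat k - of_nat i)))) (C.u i)"
      by (simp only: V_int gen_act_scale Suc C.act_c_u_Suc down scale_right_diff_distrib scale_scale mult.assoc)
    have c1: "\<beta> j * (C.\<epsilon> j / 2) = C.\<epsilon> j * ((of_nat j + 1) * \<beta> (Suc j))"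
      using \<beta>_Suc[of j] by simp
    have c2: "\<beta> j * (C.\<epsilon> j / 2 * (4 * (of_nat i + 1) * (of_nat k - of_nat i)))
      = C.\<epsilon> j * ((of_nat k - of_nat j + 1) * \<beta> i)"
      using \<beta>_Suc[of i] by (simp add: Suc)
    show ?thesis
      unfolding act c1 c2 V_pred V_Suc by (simp add: C.\<epsilon>_def mult.assoc del: C.u.simps)
  qed
  ultimately have "basis_of diameter (\<lambda>i. V (int i)) UNIV \<and> V (- 1) = 0 \<and> V (int diameter + 1) = 0 \<and>
      (\<forall>j\<le>diameter.
        gen_act Gx (V (int j)) = iscale ((- 1) ^ j * (int diameter - 2 * int j)) (V (int j)) \<and>
        gen_act Gy (V (int j)) = iscale (int diameter - int j + 1) (V (int j - 1))
          + iscale (int j + 1) (V (int j + 1)) \<and>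
        gen_act Gz (V (int j)) = iscale ((- 1) ^ (j + 1) * (int diameter - int j + 1)) (V (int j - 1))
          + iscale ((- 1) ^ j * (int j + 1)) (V (int j + 1)))"
    using eigen by (simp add: basis(2) V_def[of "- 1"])
  then show ?thesis using even by (auto simp: basis(2) Let_def)
qed

text \<open>Since the eigenvalue is a fixed point, one ladder operator preserves its eigenspace, and
  the chain is closed at its lower end by an eigenvector of that operator. The chain runs away from
  the eigenvalue of smallest absolute value, opposite to the numbering of the standard
  basis.\<close>

lemma type_AB:
  assumes "v \<noteq> 0" and v: "gen_act Gx v = scale (of_int r) v" and r: "r = 1 \<or> r = - 1"
  shows "\<exists>n. has_type (AB n)"
proof -
  obtain m where m: "casimir_level m" by (rule casimir_level_exists)
  have abc: "distinct [Gx, Gy, Gz]" by simp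
  define \<rho> :: 'k where "\<rho> = of_int r"
  have \<rho>: "\<rho> * \<rho> = 1" using r by (auto simp: \<rho>_def)
  have v': "gen_act Gx v = scale \<rho> v" using v by (simp add: \<rho>_def)
  \<comment> \<open>On this eigenspace the ladder operator R of sign \<open>\<rho>\<close> squares
    to m = \<open>\<tau>\<close>^2. Hence either R + \<open>\<tau>\<close> kills v, or it maps v to
    an eigenvector of R for \<open>\<tau>\<close>.\<close>
  obtain \<tau> w where w: "w \<noteq> 0" "gen_act Gx w = scale \<rho> w" "ladder Gy Gz \<rho> w = scale \<tau> w"
  proof -
    obtain \<tau> where \<tau>: "\<tau> ^ 2 = m" using nth_root_exists[of 2 m] by auto
    let ?R = "ladder Gy Gz \<rho>"
    have Rv: "gen_act Gx (?R v) = scale \<rho> (?R v)"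
      using ladder_eigen[OF abc \<rho> v'] by simp
    have RRv: "?R (?R v) = scale (\<tau> * \<tau>) v"
      using ladder_ladder[OF abc \<rho> v' m] by (simp add: \<tau>[symmetric] power2_eq_square)
    show thesis
    proof (cases "?R v + scale \<tau> v = 0")
      case True
      then have "?R v = scale (- \<tau>) v" by (simp add: eq_neg_iff_add_eq_0)
      then show thesis by (rule that[OF \<open>v \<noteq> 0\<close> v'])
    next
      case False
      have "?R (?R v + scale \<tau> v) = scale \<tau> (?R v + scale \<tau> v)"
        by (simp add: ladder_add ladder_scale RRv scale_right_distrib add.commute)
      moreover have "gen_act Gx (?R v + scale \<tau> v) = scale \<rho> (?R v + scale \<tau> v)"
        by (simp add: act_add_right gen_act_scale Rv v' scale_right_distrib mult.commute)
      ultimately show thesis using False by (intro that) simp_all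
    qed
  qed
  \<comment> \<open>The ladder operator of sign \<open>\<rho>\<close> only reproduces w, so the
    chain leaves with sign \<open>- \<rho>\<close>. Then \<open>\<kappa>\<close> = -1 encodes the
    eigenvalue \<open>\<rho>\<close>, and as -1 is no natural number the eigenvalues never
    repeat.\<close>
  interpret C: ladder_chain scale act Basis Gx Gy Gz "- \<rho>" "- 1" m w
    by unfold_locales (use m w \<rho> in auto)
  obtain d where d: "\<And>i. i \<le> d \<Longrightarrow> C.u i \<noteq> 0" "C.u (Suc d) = 0" by (rule C.last_nonzero) blast
  have "m = (- 1 - 2 * of_nat d - 1)\<^sup>2" using C.u_down[of d] d by (simp del: C.u.simps)
  then have m_eq: "m = (2 * (of_nat d + 1))\<^sup>2" by (simp add: power2_eq_square algebra_simps)
  have down: "m - (- 1 - 2 * of_nat i - 1)\<^sup>2 = 4 * (of_nat d - of_nat i) * (of_nat d + of_nat i + 2)" for i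
    unfolding m_eq by (simp add: power2_eq_square algebra_simps)
  have ne: "(- 1 :: 'k) \<noteq> of_nat i" for i
    by (metis add.commute add_eq_0_iff of_nat_Suc of_nat_neq_0)
  have "ladder Gy Gz \<rho> w \<in> span (C.u ` {0..d})"
    unfolding w(3) by (intro span_scale span_base image_eqI[of _ _ 0]) simp_all
  then have basis: "basis_of d C.u UNIV" "diameter = d"
    using C.u_basis[of d, OF _ d(2,1) ne] by simp_all
  have "scale (\<tau> * \<tau>) w = scale m w"
    using ladder_ladder[OF abc \<rho> w(2) m] by (simp add: w(3) ladder_scale)
  then have "\<tau> * \<tau> = (2 * (of_nat d + 1)) * (2 * (of_nat d + 1))"
    using w(1) m_eq by (simp add: power2_eq_square)
  then have "\<tau> = 2 * (of_nat d + 1) \<or> \<tau> = - (2 * (of_nat d + 1))" by (rule square_eq_iff[THEN iffD1])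
  \<comment> \<open>The factor (-1)^d anticipates the one in the action of y, so that t can become
    \<open>hat Gy n\<close>.\<close>
  then obtain t :: int where t: "t = 1 \<or> t = - 1"
    and \<tau>: "\<tau> = 2 * (of_int t * (- 1) ^ d) * (of_nat d + 1)"
    by (cases "even d") (force intro: that[of 1] that[of "- 1"])+
  define q :: 'k where "q = of_int t * (- 1) ^ d"
  have q: "q * q = 1" using t by (auto simp: q_def simp flip: power_add)
  \<comment> \<open>The four labels n correspond to the four pairs of signs (r, t).\<close>
  obtain n where hat: "hat Gx n = r" "hat Gy n = t" "hat Gz n = r * t"
    using r t
    by (cases "r = 1"; cases "t = 1")
      (auto simp: hat_def intro: that[of None] that[of "Some Gx"] that[of "Some Gy"] that[of "Some Gz"])
  \<comment> \<open>The recursion turns the forward coefficient 1/2 into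
    \<open>q * (of_nat d + of_nat j + 2)\<close>, which is the standard coefficient 2d - i + 2 at i
    = d - j.\<close>
  define \<beta> :: "nat \<Rightarrow> 'k" where "\<beta> n = rec_nat 1 (\<lambda>j b. q * b / (2 * (of_nat d + of_nat j + 2))) n" for n
  have pos: "(of_nat d + of_nat j + 2 :: 'k) \<noteq> 0" for j
  proof -
    have "(of_nat d + of_nat j + 2 :: 'k) = of_nat (Suc (Suc (d + j)))" by simp
    then show ?thesis by (metis of_nat_neq_0)
  qed
  have \<beta>_0: "\<beta> 0 = 1" by (simp add: \<beta>_def)
  have \<beta>_Suc: "q * \<beta> j = 2 * (of_nat d + of_nat j + 2) * \<beta> (Suc j)" for j
  proof -
    have "\<beta> (Suc j) = q * \<beta> j / (2 * (of_nat d + of_nat j + 2))" unfolding \<beta>_def nat.rec ..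
    moreover have "2 * (of_nat d + of_nat j + 2 :: 'k) \<noteq> 0"
      using pos[of j] by (metis mult_eq_0_iff zero_neq_numeral)
    ultimately show ?thesis by (metis nonzero_mult_div_cancel_left times_divide_eq_right)
  qed
  have \<beta>_Suc': "\<beta> j = 2 * q * (of_nat d + of_nat j + 2) * \<beta> (Suc j)" for j
  proof -
    have "\<beta> j = q * (q * \<beta> j)" using q by (simp flip: mult.assoc)
    then show ?thesis unfolding \<beta>_Suc by (simp only: mult_ac)
  qed
  have \<beta>_nz: "\<beta> j \<noteq> 0" for j
  proof (induction j)
    case (Suc j)
    then show ?case using \<beta>_Suc'[of j] by auto
  qed (simp add: \<beta>_0)
  have half: "1 / 2 = q * ((of_nat d + of_nat 0 + 2) * \<beta> (Suc 0))"
  proof -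
    have "1 = 2 * x \<Longrightarrow> 1 / 2 = x" for x :: 'k by (simp add: mult.commute)
    then show ?thesis using \<beta>_Suc'[of 0] by (simp only: \<beta>_0 mult.assoc)
  qed
  have up: "\<beta> (Suc i) * (1 / 2 * (4 * (of_nat d - of_nat i) * (of_nat d + of_nat i + 2)))
      = q * ((of_nat d - of_nat i) * \<beta> i)" for i
  proof -
    have "x * (1 / 2 * (4 * y * z)) = y * (2 * z * x)" for x y z :: 'k by simp
    then show ?thesis by (simp only: \<beta>_Suc[symmetric] mult.left_commute)
  qed
  define V where "V i = scale (\<beta> (nat (int d - i))) (C.u (nat (int d - i)))" for i \<comment> \<open>\<open>nat\<close> truncates at \<open>i = d + 1\<close>, so that \<open>V (d + 1) = V d\<close>\<close>
  have V_int: "V (int d - int j) = scale (\<beta> j) (C.u j)" for j by (simp add: V_def)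
  have V_pred: "V (int d - int j - 1) = scale (\<beta> (Suc j)) (C.u (Suc j))" for j
    using V_int[of "Suc j"] by (simp add: algebra_simps del: C.u.simps)
  have V_Suc: "V (int d - int (Suc j) + 1) = scale (\<beta> j) (C.u j)" for j
    using V_int[of j] by simp
  have V_top: "V (int d + 1) = C.u 0" by (simp add: V_def \<beta>_0)
  have eigen: "gen_act Gx (V (int d - int j)) = scale (C.\<epsilon> j * (- 1 - 2 * of_nat j)) (V (int d - int j))" for j
    using C.u_eigen[of j] by (simp add: V_int gen_act_scale mult.commute)
  have eigen': "gen_act Gx (V (int j)) = scale (C.\<epsilon> (d - j) * (- 1 - 2 * of_nat (d - j))) (V (int j))"
    if "j \<le> d" for j
    using eigen[of "d - j"] that by (simp add: of_nat_diff)
  have "basis_of d (\<lambda>i. V (int i)) UNIV"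
  proof (rule eigenbasis[OF linear_gen_act[of Gx] _ eigen'])
    show "V (int i) \<noteq> 0" if "i \<le> d" for i
      using d(1)[of "d - i"] that V_int[of "d - i"] by (simp add: of_nat_diff \<beta>_nz)
    have "inj_on ((\<lambda>i. C.\<epsilon> i * (- 1 - 2 * of_nat i)) \<circ> (\<lambda>i. d - i)) {0..d}"
      by (intro comp_inj_on inj_onI inj_on_subset[OF C.eigenvalues_inj[of d]] ne) auto
    then show "inj_on (\<lambda>i. C.\<epsilon> (d - i) * (- 1 - 2 * of_nat (d - i))) {0..d}"
      by (simp add: comp_def)
    show "dim UNIV = Suc d" by (rule basis_of_dim[OF basis(1)])
  qed
  moreover have "V (- 1) = 0"
    using V_int[of "Suc d"] d(2) by (simp del: C.u.simps)
  moreover have "V (int d + 1) = V (int d)" using V_int[of 0] by (simp add: V_top \<beta>_0)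
  moreover have act_y: "gen_act Gy (V (int d - int j))
      = scale q (scale (of_nat d + of_nat j + 2) (V (int d - int j - 1))
        + scale (of_nat d - of_nat j + 1) (V (int d - int j + 1)))" for j
  proof (cases j)
    case 0
    have act: "gen_act Gy (V (int d - int j)) = scale (1 / 2) (C.u (Suc 0))
        + scale (1 / 2 * \<tau>) (C.u 0)"
      using C.act_b_u_0 w(3) V_int[of 0] by (simp add: 0 \<beta>_0 scale_right_distrib)
    \<comment> \<open>The loop at the start of the chain becomes the convention v_{d+1} = v_d of the
      standard basis.\<close>
    have c2: "1 / 2 * \<tau> = q * (of_nat d + 1)" by (simp add: \<tau> q_def C.\<epsilon>_def)
    show ?thesis
      unfolding act c2 unfolding half 0 V_pred by (simp add: V_top scale_right_distrib mult.assoc del: C.u.simps)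
  next
    case (Suc i)
    have act: "gen_act Gy (V (int d - int j)) = scale (\<beta> j * (1 / 2)) (C.u (Suc j))
        + scale (\<beta> j * (1 / 2 * (4 * (of_nat d - of_nat i) * (of_nat d + of_nat i + 2)))) (C.u i)"
      by (simp only: V_int gen_act_scale Suc C.act_b_u_Suc down scale_right_distrib scale_scale mult.assoc)
    have c1: "\<beta> j * (1 / 2) = q * ((of_nat d + of_nat j + 2) * \<beta> (Suc j))"
      using \<beta>_Suc'[of j] by simp
    have c2: "\<beta> j * (1 / 2 * (4 * (of_nat d - of_nat i) * (of_nat d + of_nat i + 2)))
      = q * ((of_nat d - of_nat i) * \<beta> i)"
      by (simp only: Suc up)
    show ?thesis
      unfolding act c1 c2 V_pred unfolding Suc V_Suc by (simp add: scale_right_distrib del: C.u.simps)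
  qed
  moreover have act_z: "gen_act Gz (V (int d - int j))
      = scale (C.\<epsilon> j * q) (scale (of_nat d + of_nat j + 2) (V (int d - int j - 1))
        - scale (of_nat d - of_nat j + 1) (V (int d - int j + 1)))" for j
  proof (cases j)
    case 0
    have act: "gen_act Gz (V (int d - int j)) = scale (- \<rho> / 2) (C.u (Suc 0))
        - scale (- \<rho> / 2 * \<tau>) (C.u 0)"
      using C.act_c_u_0 w(3) V_int[of 0] by (simp add: 0 \<beta>_0 scale_right_diff_distrib)
    have c1: "- \<rho> / 2 = C.\<epsilon> 0 * q * ((of_nat d + of_nat 0 + 2) * \<beta> (Suc 0))"
      unfolding mult.assoc half[symmetric] by (simp add: C.\<epsilon>_def)
    have c2: "- \<rho> / 2 * \<tau> = C.\<epsilon> 0 * q * (of_nat d + 1)" by (simp add: \<tau> q_def C.\<epsilon>_def)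
    show ?thesis
      unfolding act c2 unfolding c1 0 V_pred by (simp add: V_top scale_right_diff_distrib mult.assoc del: C.u.simps)
  next
    case (Suc i)
    have act: "gen_act Gz (V (int d - int j)) = scale (\<beta> j * (C.\<epsilon> j / 2)) (C.u (Suc j))
        - scale (\<beta> j * (C.\<epsilon> j / 2 * (4 * (of_nat d - of_nat i) * (of_nat d + of_nat i + 2)))) (C.u i)"
      by (simp only: V_int gen_act_scale Suc C.act_c_u_Suc down scale_right_diff_distrib scale_scale mult.assoc)
    have c1: "\<beta> j * (C.\<epsilon> j / 2) = C.\<epsilon> j * (q * ((of_nat d + of_nat j + 2) * \<beta> (Suc j)))"
      using \<beta>_Suc'[of j] by simp
    have c2: "\<beta> j * (C.\<epsilon> j / 2 * (4 * (of_nat d - of_nat i) * (of_nat d + of_nat i + 2)))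
      = C.\<epsilon> j * (q * ((of_nat d - of_nat i) * \<beta> i))"
    proof -
      have "x * (e / 2 * y) = e * (x * (1 / 2 * y))" for x e y :: 'k by simp
      from this[of _ "C.\<epsilon> j"] show ?thesis by (simp only: Suc up)
    qed
    show ?thesis
      unfolding act c1 c2 V_pred unfolding Suc V_Suc by (simp add: scale_right_diff_distrib mult.assoc del: C.u.simps)
  qed
  moreover have "gen_act Gx (V (int j)) =
          iscale (hat Gx n * (- 1) ^ (diameter + j) * (2 * int diameter - 2 * int j + 1)) (V (int j)) \<and>
        gen_act Gy (V (int j)) = iscale (hat Gy n * (- 1) ^ diameter)
          (iscale (2 * int diameter - int j + 2) (V (int j - 1)) + iscale (int j + 1) (V (int j + 1))) \<and>
        gen_act Gz (V (int j)) = iscale (hat Gz n)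
          (iscale ((- 1) ^ (j + 1) * (2 * int diameter - int j + 2)) (V (int j - 1))
            + iscale ((- 1) ^ j * (int j + 1)) (V (int j + 1)))" if "j \<le> d" for j
  proof -
    define i where "i = d - j"
    have j: "int j = int d - int i" "j = d - i" "i \<le> d" using that by (simp_all add: i_def of_nat_diff)
    have sgn: "(- 1) ^ (d + j) = ((- 1) ^ i :: 'k)" "(- 1) ^ j = ((- 1) ^ d * (- 1) ^ i :: 'k)"
      using j by (auto simp: minus_one_power_iff)
    have \<epsilon>: "C.\<epsilon> i = - (of_int r * (- 1) ^ i)" unfolding C.\<epsilon>_def unfolding \<rho>_def by simp
    have i: "(of_nat i :: 'k) = of_nat d - of_nat j" using j(2,3) by (simp add: of_nat_diff)
    have cx: "C.\<epsilon> i * (- 1 - 2 * of_nat i)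
        = of_int (hat Gx n * (- 1) ^ (diameter + j) * (2 * int diameter - 2 * int j + 1))"
      unfolding \<epsilon> i basis(2) hat of_int_mult of_int_power of_int_minus of_int_1 sgn
      by (simp add: algebra_simps)
    have cy: "of_nat d + of_nat i + 2 = (of_int (2 * int diameter - int j + 2) :: 'k)"
      "of_nat d - of_nat i + 1 = (of_int (int j + 1) :: 'k)"
      "q = of_int (hat Gy n * (- 1) ^ diameter)"
      by (simp_all add: i basis(2) hat q_def)
    have cz: "C.\<epsilon> i * q = - (of_int (hat Gz n) * (- 1) ^ j)"
      by (simp add: \<epsilon> hat q_def sgn)
    have "gen_act Gz (V (int j)) = iscale (hat Gz n)
          (iscale ((- 1) ^ (j + 1) * (2 * int diameter - int j + 2)) (V (int j - 1))
            + iscale ((- 1) ^ j * (int j + 1)) (V (int j + 1)))"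
      using act_z[of i] unfolding j(1)[symmetric] cz unfolding cy
      by (simp add: scale_right_distrib scale_right_diff_distrib mult.assoc)
    then show ?thesis
      using eigen[of i] act_y[of i] unfolding j(1)[symmetric] cx unfolding cy by blast
  qed
  ultimately have "basis_of diameter (\<lambda>i. V (int i)) UNIV \<and> V (- 1) = 0 \<and>
      V (int diameter + 1) = V (int diameter) \<and>
      (\<forall>j\<le>diameter.
        gen_act Gx (V (int j)) =
          iscale (hat Gx n * (- 1) ^ (diameter + j) * (2 * int diameter - 2 * int j + 1)) (V (int j)) \<and>
        gen_act Gy (V (int j)) = iscale (hat Gy n * (- 1) ^ diameter)
          (iscale (2 * int diameter - int j + 2) (V (int j - 1)) + iscale (int j + 1) (V (int j + 1))) \<and>
        gen_act Gz (V (int j)) = iscale (hat Gz n)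
          (iscale ((- 1) ^ (j + 1) * (2 * int diameter - int j + 2)) (V (int j - 1))
            + iscale ((- 1) ^ j * (int j + 1)) (V (int j + 1))))"
    by (simp add: basis(2))
  then have "has_type (AB n)" unfolding has_type.simps Let_def by blast
  then show ?thesis by blast
qed

end

section \<open>Primitive idempotents\<close>

context vector_space
begin

lemma eigenvector_coordinates:
  assumes u: "basis_of d u UNIV" and T: "Vector_Spaces.linear scale scale T"
    and eigen: "\<And>i. i \<le> d \<Longrightarrow> T (u i) = scale (\<theta> i) (u i)"
    and v: "T (\<Sum>i\<le>d. scale (\<alpha> i) (u i)) = scale c (\<Sum>i\<le>d. scale (\<alpha> i) (u i))" and "i \<le> d"
  shows "\<alpha> i = 0 \<or> \<theta> i = c"
proof -
  interpret T: Vector_Spaces.linear scale scale T by (rule T)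
  have "(\<Sum>i\<le>d. scale (\<alpha> i * \<theta> i) (u i)) = (\<Sum>i\<le>d. scale (\<alpha> i * c) (u i))"
    using v eigen by (simp add: T.sum T.scale scale_sum_right mult.commute)
  then have "(\<Sum>i\<le>d. scale (\<alpha> i * (\<theta> i - c)) (u i)) = 0"
    by (simp add: right_diff_distrib scale_left_diff_distrib sum_subtractf)
  then have "\<alpha> i * (\<theta> i - c) = 0"
    using basis_of_coeffs_zero[OF u, of "\<lambda>i. \<alpha> i * (\<theta> i - c)"] \<open>i \<le> d\<close> by simp
  then show ?thesis by simp
qed

lemma shift_up_sum:
  fixes u :: "nat \<Rightarrow> 'b"
  shows "(\<Sum>i\<le>n. scale (\<alpha> i) (u (Suc i)))
    = (\<Sum>i\<le>n. scale (if i = 0 then 0 else \<alpha> (i - 1)) (u i)) + scale (\<alpha> n) (u (Suc n))"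
  by (induction n) simp_all

text \<open>At i = 0 the truncated predecessor points back to \<open>u 0\<close>, so its coefficient
  has to be zero.\<close>

lemma shift_down_sum:
  fixes u :: "nat \<Rightarrow> 'b"
  assumes "\<alpha> 0 = 0"
  shows "(\<Sum>i\<le>n. scale (\<alpha> i) (u (i - 1))) = (\<Sum>i\<le>n. scale (if i < n then \<alpha> (Suc i) else 0) (u i))"
proof (induction n)
  case 0
  then show ?case using assms by simp
next
  case (Suc n)
  have "(\<Sum>i\<le>n. scale (if i < n then \<alpha> (Suc i) else 0) (u i)) + scale (\<alpha> (Suc n)) (u n)
      = (\<Sum>i\<le>n. scale (if i < Suc n then \<alpha> (Suc i) else 0) (u i))"
    by (cases n) simp_all
  then show ?case using Suc by simp
qed

end

context acs_module
begin

text \<open>Resolves the definite description in \<open>prim_idem\<close>: the coordinate projection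
  has the required properties, and any other candidate agrees with it on the eigenbasis.\<close>

lemma prim_idem_eigenbasis:
  assumes u: "basis_of d u UNIV" and eigen: "\<And>i. i \<le> d \<Longrightarrow> gen_act a (u i) = scale (eigval a i) (u i)"
    and inj: "inj_on (eigval a) {0..d}" and "i \<le> d"
  shows "prim_idem a i (\<Sum>j\<le>d. scale (\<alpha> j) (u j)) = scale (\<alpha> i) (u i)"
proof -
  let ?B = "u ` {0..d}"
  have B: "inj_on u {0..d}" "independent ?B" "v \<in> span ?B" for v using u by (auto simp: basis_of_def)
  define p where "p v = scale (representation ?B v (u i)) (u i)" for v
  have lin: "Vector_Spaces.linear scale scale p"
    by (simp add: Vector_Spaces.linear_iff vector_space_axioms p_def representation_add
        representation_scale B scale_left_distrib)
  interpret p: Vector_Spaces.linear scale scale p by (rule lin)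
  have p_u: "p (u j) = (if j = i then u i else 0)" if "j \<le> d" for j
    using that \<open>i \<le> d\<close> inj_onD[OF B(1), of i j] by (auto simp: p_def representation_basis B)
  have p_sum: "p (\<Sum>j\<le>d. scale (\<alpha> j) (u j)) = scale (\<alpha> i) (u i)" for \<alpha>
  proof -
    have "p (\<Sum>j\<le>d. scale (\<alpha> j) (u j)) = (\<Sum>j\<le>d. if j = i then scale (\<alpha> i) (u i) else 0)"
      unfolding p.sum p.scale by (intro sum.cong) (auto simp: p_u)
    then show ?thesis using \<open>i \<le> d\<close> by simp
  qed
  have eigenspace: "p v = (if c = eigval a i then v else 0)" if "v \<in> eigenspace a c" for v c
  proof -
    obtain \<alpha> where v: "v = (\<Sum>j\<le>d. scale (\<alpha> j) (u j))" using u by (rule basis_of_coordinates)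
    have zero: "\<alpha> j = 0 \<or> eigval a j = c" if "j \<le> d" for j
      using \<open>v \<in> eigenspace a c\<close> eigenvector_coordinates[OF u linear_gen_act eigen, of \<alpha> c j] that
      by (simp add: eigenspace_def v)
    show ?thesis
    proof (cases "c = eigval a i")
      case True
      then have "\<alpha> j = 0" if "j \<le> d" "j \<noteq> i" for j
        using zero[OF that(1)] inj_onD[OF inj, of j i] that \<open>i \<le> d\<close> by auto
      then have "v = (\<Sum>j\<le>d. if j = i then scale (\<alpha> i) (u i) else 0)"
        unfolding v by (intro sum.cong) auto
      then show ?thesis using \<open>i \<le> d\<close> True p_sum[of \<alpha>] v by simp
    next
      case False
      then show ?thesis using zero[OF \<open>i \<le> d\<close>] p_sum[of \<alpha>] v by auto
    qed
  qed
  have range_p: "range p \<subseteq> eigenspace a (eigval a i)"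
    by (auto simp: eigenspace_def p_def gen_act_scale mult.commute eigen[OF \<open>i \<le> d\<close>])
  have "prim_idem a i = p"
    unfolding prim_idem_def
  proof (rule the_equality)
    show "Vector_Spaces.linear scale scale p \<and> range p \<subseteq> eigenspace a (eigval a i) \<and>
      (\<forall>v\<in>eigenspace a (eigval a i). p v = v) \<and>
      (\<forall>c. c \<noteq> eigval a i \<longrightarrow> (\<forall>v\<in>eigenspace a c. p v = 0))"
      using lin eigenspace range_p by simp
  next
    fix q assume q: "Vector_Spaces.linear scale scale q \<and> range q \<subseteq> eigenspace a (eigval a i) \<and>
      (\<forall>v\<in>eigenspace a (eigval a i). q v = v) \<and>
      (\<forall>c. c \<noteq> eigval a i \<longrightarrow> (\<forall>v\<in>eigenspace a c. q v = 0))"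
    show "q = p"
    proof (rule basis_of_linear_eqI[OF u])
      fix j assume "j \<le> d"
      then have "u j \<in> eigenspace a (eigval a j)" using eigen by (simp add: eigenspace_def)
      moreover have "eigval a j = eigval a i \<longleftrightarrow> j = i"
        using inj_onD[OF inj, of j i] \<open>i \<le> d\<close> \<open>j \<le> d\<close> by auto
      ultimately show "q (u j) = p (u j)" using q p_u[OF \<open>j \<le> d\<close>] by (cases "j = i") auto
    qed (use q lin in auto)
  qed
  then show ?thesis using p_sum by simp
qed

text \<open>Each w_j receives the coefficient j from below and L - j from above, together L. The
  hypothesis \<open>high\<close> closes the upper end for both types: in B both sides vanish, in AB
  it reads (d + 1) w_d = (d + 1) w_{d+1}.\<close>

lemma tridiagonal_eigenvector:
  fixes w :: "int \<Rightarrow> 'v"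
  assumes act: "\<And>j. j \<le> d \<Longrightarrow> gen_act g (w (int j)) = scale \<sigma>
      (scale (of_nat L - of_nat j + 1) (w (int j - 1)) + scale (of_nat j + 1) (w (int j + 1)))"
    and low: "w (- 1) = 0"
    and high: "scale (of_nat L - of_nat d) (w (int d)) = scale (of_nat d + 1) (w (int d + 1))"
  shows "gen_act g (\<Sum>j\<le>d. w (int j)) = scale (\<sigma> * of_nat L) (\<Sum>j\<le>d. w (int j))"
proof -
  \<comment> \<open>In a partial sum w_n still lacks its contribution from n + 1, and w_{n+1} has
    already received one from n.\<close>
  have partial: "gen_act g (\<Sum>j\<le>n. w (int j)) = scale \<sigma> (scale (of_nat L) (\<Sum>j\<le>n. w (int j))
      - scale (of_nat L - of_nat n) (w (int n)) + scale (of_nat n + 1) (w (int n + 1)))" if "n \<le> d" for n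
    using that
  proof (induction n)
    case 0
    then show ?case using act[of 0] low by simp
  next
    case (Suc n)
    have "w (int (Suc n) - 1) = w (int n)" by simp
    then have "gen_act g (w (int (Suc n))) = scale \<sigma> (scale (of_nat L - of_nat n) (w (int n))
        + scale (of_nat (Suc n) + 1) (w (int (Suc n) + 1)))"
      using act[OF Suc.prems] by simp
    moreover have "scale (of_nat L) (w (int (Suc n))) - scale (of_nat L - of_nat (Suc n)) (w (int (Suc n)))
      = scale (of_nat n + 1) (w (int n + 1))"
      by (simp add: add.commute flip: scale_left_diff_distrib)
    moreover have "scale \<sigma> (S - x + y) + scale \<sigma> (x + z) = scale \<sigma> (S + y + z)" for S x y z
      by (simp flip: scale_right_distrib)
    moreover have "gen_act g (\<Sum>j\<le>n. w (int j)) = scale \<sigma> (scale (of_nat L) (\<Sum>j\<le>n. w (int j))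
      - scale (of_nat L - of_nat n) (w (int n)) + scale (of_nat n + 1) (w (int n + 1)))"
      using Suc by simp
    ultimately have "gen_act g (\<Sum>j\<le>Suc n. w (int j)) = scale \<sigma> (scale (of_nat L) (\<Sum>j\<le>n. w (int j))
      + (scale (of_nat L) (w (int (Suc n))) - scale (of_nat L - of_nat (Suc n)) (w (int (Suc n))))
      + scale (of_nat (Suc n) + 1) (w (int (Suc n) + 1)))"
      by (simp only: sum.atMost_Suc act_add_right)
    then show ?case by (simp only: sum.atMost_Suc scale_right_distrib add_diff_eq)
  qed
  show ?thesis using partial[of d] high by simp
qed

end

section \<open>Extremal eigenvectors\<close>

context irreducible_acs_module
begin

lemma has_type_exists: "\<exists>t. has_type t"
proof (cases "\<exists>v \<rho>. v \<noteq> 0 \<and> \<rho> * \<rho> = 1 \<and> gen_act Gx v = scale \<rho> v")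
  case True
  then obtain v \<rho> where v: "v \<noteq> 0" "\<rho> * \<rho> = 1" "gen_act Gx v = scale \<rho> v" by blast
  then obtain r :: int where "r = 1 \<or> r = - 1" "\<rho> = of_int r"
    using square_eq_1_iff[of \<rho>] by (metis of_int_1 of_int_minus)
  then show ?thesis using type_AB[of v r] v by blast
next
  case False
  then have "has_type B" by (intro type_B) blast
  then show ?thesis by blast
qed

text \<open>Type B has all signs 1 and L = d; type AB has
  \<open>s a = hat a n * (- 1) ^ diameter\<close> and L = 2d + 1. The rule for the product of signs
  reflects that the three values \<open>hat a n\<close> multiply to 1 for every label n.\<close>

lemma has_type_unified:
  assumes "has_type t"
  obtains s :: "gen \<Rightarrow> int" and L :: nat and v :: "int \<Rightarrow> 'v"
  where "even diameter \<and> L = diameter \<or> L = 2 * diameter + 1"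
    and "\<And>a. s a = 1 \<or> s a = - 1"
    and "s Gx * s Gy * s Gz = (- 1) ^ diameter"
    and "\<And>a i. theta t diameter a i = s a * (- 1) ^ i * (int L - 2 * int i)"
    and "basis_of diameter (\<lambda>i. v (int i)) UNIV"
    and "v (- 1) = 0"
    and "scale (of_nat L - of_nat diameter) (v (int diameter))
      = scale (of_nat diameter + 1) (v (int diameter + 1))"
    and "gen_act Gx (v 0) = scale (of_int (s Gx) * of_nat L) (v 0)"
    and "\<And>j. j \<le> diameter \<Longrightarrow> gen_act Gy (v (int j)) = scale (of_int (s Gy))
      (scale (of_nat L - of_nat j + 1) (v (int j - 1)) + scale (of_nat j + 1) (v (int j + 1)))"
    and "\<And>j. j \<le> diameter \<Longrightarrow> gen_act Gz (v (int j)) = scale (of_int (s Gz) * (- 1) ^ (diameter + j))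
      (scale (of_nat j + 1) (v (int j + 1)) - scale (of_nat L - of_nat j + 1) (v (int j - 1)))"
proof (cases t)
  case B
  from assms[unfolded B has_type.simps Let_def] obtain v :: "int \<Rightarrow> 'v" where even: "even diameter"
    and v: "basis_of diameter (\<lambda>i. v (int i)) UNIV" "v (- 1) = 0" "v (int diameter + 1) = 0"
    and act: "\<And>j. j \<le> diameter \<Longrightarrow>
        gen_act Gx (v (int j)) = iscale ((- 1) ^ j * (int diameter - 2 * int j)) (v (int j)) \<and>
        gen_act Gy (v (int j)) = iscale (int diameter - int j + 1) (v (int j - 1))
          + iscale (int j + 1) (v (int j + 1)) \<and>
        gen_act Gz (v (int j)) = iscale ((- 1) ^ (j + 1) * (int diameter - int j + 1)) (v (int j - 1))
          + iscale ((- 1) ^ j * (int j + 1)) (v (int j + 1))"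
    by blast
  show thesis
    by (rule that[of diameter "\<lambda>_. 1" v])
      (use even v act act[of 0] in \<open>simp_all add: B scale_right_diff_distrib power_add\<close>)
next
  case (AB n)
  from assms[unfolded AB has_type.simps Let_def] obtain v :: "int \<Rightarrow> 'v" where
    v: "basis_of diameter (\<lambda>i. v (int i)) UNIV" "v (- 1) = 0" "v (int diameter + 1) = v (int diameter)"
    and act: "\<And>j. j \<le> diameter \<Longrightarrow>
        gen_act Gx (v (int j)) =
          iscale (hat Gx n * (- 1) ^ (diameter + j) * (2 * int diameter - 2 * int j + 1)) (v (int j)) \<and>
        gen_act Gy (v (int j)) = iscale (hat Gy n * (- 1) ^ diameter)
          (iscale (2 * int diameter - int j + 2) (v (int j - 1)) + iscale (int j + 1) (v (int j + 1))) \<and>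
        gen_act Gz (v (int j)) = iscale (hat Gz n)
          (iscale ((- 1) ^ (j + 1) * (2 * int diameter - int j + 2)) (v (int j - 1))
            + iscale ((- 1) ^ j * (int j + 1)) (v (int j + 1)))"
    by blast
  define s where "s a = hat a n * (- 1) ^ diameter" for a
  have hat: "hat a n = 1 \<or> hat a n = - 1" for a by (simp add: hat_def)
  have hat_prod: "hat Gx n * hat Gy n * hat Gz n = 1"
    by (cases n; cases "the n") (auto simp: hat_def)
  have sq: "((- 1) ^ diameter * (- 1) ^ diameter :: 'k) = 1" "((- 1) ^ diameter * (- 1) ^ diameter :: int) = 1"
    by (simp_all flip: power_mult_distrib)
  show thesis
  proof (rule that[of "2 * diameter + 1" s v])
    show "s a = 1 \<or> s a = - 1" for a
      using hat[of a] by (auto simp: s_def minus_one_power_iff)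
    have "s Gx * s Gy * s Gz = (hat Gx n * hat Gy n * hat Gz n) * ((- 1) ^ diameter * (- 1) ^ diameter) * (- 1) ^ diameter"
      by (simp only: s_def mult_ac)
    then show "s Gx * s Gy * s Gz = (- 1) ^ diameter" by (simp add: hat_prod sq)
    show "theta t diameter a i = s a * (- 1) ^ i * (int (2 * diameter + 1) - 2 * int i)" for a i
      by (simp add: AB s_def power_add algebra_simps)
    show "gen_act Gx (v 0) = scale (of_int (s Gx) * of_nat (2 * diameter + 1)) (v 0)"
      using act[of 0] by (simp add: s_def)
    show "gen_act Gy (v (int j)) = scale (of_int (s Gy))
      (scale (of_nat (2 * diameter + 1) - of_nat j + 1) (v (int j - 1)) + scale (of_nat j + 1) (v (int j + 1)))"
      if "j \<le> diameter" for j
      using act[OF that] by (simp add: s_def algebra_simps)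
    show "gen_act Gz (v (int j)) = scale (of_int (s Gz) * (- 1) ^ (diameter + j))
      (scale (of_nat j + 1) (v (int j + 1)) - scale (of_nat (2 * diameter + 1) - of_nat j + 1) (v (int j - 1)))"
      if "j \<le> diameter" for j
    proof -
      have "of_int (s Gz) * (- 1) ^ (diameter + j) = (of_int (hat Gz n) * (- 1) ^ j :: 'k)"
        using sq by (simp add: s_def power_add mult_ac)
      moreover have "gen_act Gz (v (int j)) = iscale (hat Gz n)
          (iscale ((- 1) ^ (j + 1) * (2 * int diameter - int j + 2)) (v (int j - 1))
            + iscale ((- 1) ^ j * (int j + 1)) (v (int j + 1)))"
        using act[OF that] by blast
      moreover have "of_nat (2 * diameter + 1) - of_nat j + 1 = (of_int (2 * int diameter - int j + 2) :: 'k)"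
        by simp
      ultimately show ?thesis
        by (simp add: scale_right_diff_distrib scale_right_distrib mult.assoc)
    qed
  qed (use v in simp_all)
qed

lemma type_data:
  assumes "has_type t"
  obtains s :: "gen \<Rightarrow> 'k" and L :: nat
  where "even diameter \<and> L = diameter \<or> L = 2 * diameter + 1"
    and "\<And>a. s a * s a = 1"
    and "\<And>a i. of_int (theta t diameter a i) = s a * (- 1) ^ i * (of_nat L - 2 * of_nat i)"
    and "\<And>a. \<exists>v. v \<noteq> 0 \<and> gen_act a v = scale (s a * of_nat L) v"
    and "casimir_level ((of_nat L + 1)\<^sup>2)"
    and "dim UNIV = Suc diameter"
proof -
  let ?d = diameter
  obtain s :: "gen \<Rightarrow> int" and L :: nat and v :: "int \<Rightarrow> 'v"
    where L: "even diameter \<and> L = diameter \<or> L = 2 * diameter + 1"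
      and s: "\<And>a. s a = 1 \<or> s a = - 1"
      and s_prod: "s Gx * s Gy * s Gz = (- 1) ^ diameter"
      and theta: "\<And>a i. theta t diameter a i = s a * (- 1) ^ i * (int L - 2 * int i)"
      and basis: "basis_of diameter (\<lambda>i. v (int i)) UNIV"
      and low: "v (- 1) = 0"
      and high: "scale (of_nat L - of_nat diameter) (v (int diameter))
        = scale (of_nat diameter + 1) (v (int diameter + 1))"
      and act_x: "gen_act Gx (v 0) = scale (of_int (s Gx) * of_nat L) (v 0)"
      and act_y: "\<And>j. j \<le> diameter \<Longrightarrow> gen_act Gy (v (int j)) = scale (of_int (s Gy))
        (scale (of_nat L - of_nat j + 1) (v (int j - 1)) + scale (of_nat j + 1) (v (int j + 1)))"
      and act_z: "\<And>j. j \<le> diameter \<Longrightarrow> gen_act Gz (v (int j)) = scale (of_int (s Gz) * (- 1) ^ (diameter + j))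
        (scale (of_nat j + 1) (v (int j + 1)) - scale (of_nat L - of_nat j + 1) (v (int j - 1)))"
    by (rule has_type_unified[OF assms]) (rule that, assumption+)
  define S :: "gen \<Rightarrow> 'k" where "S a = of_int (s a)" for a
  have S: "S a * S a = 1" for a using s[of a] by (auto simp: S_def)
  have "of_int (s Gx * s Gy * s Gz) = ((- 1) ^ ?d :: 'k)" using s_prod by simp
  then have S_prod: "S Gx * S Gy * S Gz = (- 1) ^ ?d" by (simp add: S_def)
  have v0: "v 0 \<noteq> 0" using basis_of_nonzero[OF basis, of 0] by simp
  have sum_nonzero: "(\<Sum>j\<le>?d. scale (\<alpha> j) (v (int j))) \<noteq> 0" if "\<alpha> 0 = 1" for \<alpha>
    using basis_of_coeffs_zero[OF basis, of \<alpha> 0] that by auto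
  have eigenvector: "\<exists>v. v \<noteq> 0 \<and> gen_act a v = scale (S a * of_nat L) v" for a
  proof (cases a)
    case Gx
    then show ?thesis using act_x v0 by (auto simp: S_def)
  next
    case Gy
    have "gen_act Gy (\<Sum>j\<le>?d. v (int j)) = scale (S Gy * of_nat L) (\<Sum>j\<le>?d. v (int j))"
      by (rule tridiagonal_eigenvector[OF _ low high]) (simp add: act_y S_def)
    then show ?thesis using sum_nonzero[of "\<lambda>_. 1"] Gy by auto
  next
    case Gz
    \<comment> \<open>These signs bring the action of z into the form of that of y: the recursion
      absorbs the sign of the forward term, and the sign of the backward term then comes out right
      as well.\<close>
    define e :: "nat \<Rightarrow> 'k" where "e n = rec_nat 1 (\<lambda>j x. (- 1) ^ (?d + j) * x) n" for n
    have e: "e 0 = 1" "e (Suc j) = (- 1) ^ (?d + j) * e j" for j by (simp_all add: e_def)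
    have sq: "(- 1) ^ n * ((- 1) ^ n * x) = x" for n and x :: 'k
      by (simp flip: mult.assoc power_mult_distrib)
    define w where "w i = scale (e (nat i)) (v i)" for i
    have w_Suc: "w (int j + 1) = scale (e (Suc j)) (v (int j + 1))" for j
      by (simp add: w_def nat_add_distrib)
    have "gen_act Gz (\<Sum>j\<le>?d. w (int j)) = scale (S Gz * of_nat L) (\<Sum>j\<le>?d. w (int j))"
    proof (rule tridiagonal_eigenvector)
      show "w (- 1) = 0" by (simp add: w_def low)
      \<comment> \<open>The sign at this step is (-1)^(2d) = 1, so the condition at the upper end
        survives the rescaling.\<close>
      have "e (Suc ?d) = e ?d" using sq[of ?d 1] by (simp add: e(2) power_add)
      then show "scale (of_nat L - of_nat ?d) (w (int ?d)) = scale (of_nat ?d + 1) (w (int ?d + 1))"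
        unfolding w_Suc using arg_cong[OF high, of "scale (e ?d)"] by (simp add: w_def mult.commute)
    next
      fix j assume "j \<le> ?d"
      have pred: "scale (- (e j * (- 1) ^ (?d + j))) (v (int j - 1)) = w (int j - 1)"
      proof (cases j)
        case 0
        then show ?thesis by (simp add: low w_def)
      next
        case (Suc i)
        have "- (e j * (- 1) ^ (?d + j)) = e i"
          using sq[of "?d + i" "e i"] by (simp add: Suc e(2) mult_ac)
        then show ?thesis by (simp add: w_def Suc)
      qed
      have suc: "scale (e j * (- 1) ^ (?d + j)) (v (int j + 1)) = w (int j + 1)"
        unfolding w_Suc by (simp add: e(2) mult.commute)
      have "gen_act Gz (w (int j)) = scale (S Gz) (scale (of_nat L - of_nat j + 1)
          (scale (- (e j * (- 1) ^ (?d + j))) (v (int j - 1)))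
        + scale (of_nat j + 1) (scale (e j * (- 1) ^ (?d + j)) (v (int j + 1))))"
        by (simp add: w_def gen_act_scale act_z[OF \<open>j \<le> ?d\<close>] S_def scale_right_diff_distrib mult_ac)
      then show "gen_act Gz (w (int j)) = scale (S Gz) (scale (of_nat L - of_nat j + 1) (w (int j - 1))
        + scale (of_nat j + 1) (w (int j + 1)))"
        unfolding pred suc .
    qed
    then show ?thesis using sum_nonzero[of e] e(1) Gz by (auto simp: w_def)
  qed
  have "casimir_level ((of_nat L + 1)\<^sup>2)"
  proof -
    obtain m where m: "casimir_level m" by (rule casimir_level_exists)
    \<comment> \<open>By the product rule for signs, y and z cancel on \<open>v 0\<close> in the
      ladder operator of sign \<open>- S Gx\<close>; its square then reveals the Casimir
      value.\<close>
    have "S Gx * (S Gz * (- 1) ^ ?d) = S Gx * S Gz * (S Gx * S Gy * S Gz)" by (simp add: S_prod)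
    also have "\<dots> = (S Gx * S Gx) * (S Gz * S Gz) * S Gy" by (simp only: mult_ac)
    finally have "S Gx * (S Gz * (- 1) ^ ?d) = S Gy" by (simp add: S)
    then have "ladder Gy Gz (- S Gx) (v 0) = 0"
      using act_y[of 0] act_z[of 0] by (simp add: ladder_def low flip: S_def)
    then have "scale (m - (S Gx * of_nat L - - S Gx)\<^sup>2) (v 0) = 0"
      using ladder_ladder[of Gx Gy Gz "- S Gx" "v 0" "S Gx * of_nat L" m] m act_x S
      by (simp flip: S_def)
    moreover have "(S Gx * of_nat L - - S Gx)\<^sup>2 = (S Gx * S Gx) * (of_nat L + 1)\<^sup>2"
      by (simp add: power2_eq_square algebra_simps)
    ultimately have "m = (of_nat L + 1)\<^sup>2" using v0 S by simp
    then show ?thesis using m by simp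
  qed
  then show thesis
    using that[of L S, OF L S _ eigenvector _ basis_of_dim[OF basis]] theta by (simp add: S_def)
qed

text \<open>The input is symmetric in the generators, so any of them can play the role of a. The
  lower end closes because its eigenvalue would be L + 2 up to sign, which is not in the list. At i
  = 0 the factor \<open>of_nat i\<close> cancels the truncated predecessor.\<close>

lemma ladder_eigenbasis:
  fixes \<sigma> :: 'k and L :: nat
  assumes abc: "distinct [a, b, c]"
    and L: "even diameter \<and> L = diameter \<or> L = 2 * diameter + 1"
    and \<sigma>: "\<sigma> * \<sigma> = 1" and level: "casimir_level ((of_nat L + 1)\<^sup>2)"
    and v: "v \<noteq> 0" "gen_act a v = scale (\<sigma> * of_nat L) v" and dim: "dim UNIV = Suc diameter"
  obtains u \<tau> where "basis_of diameter u UNIV"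
    and "\<And>i. gen_act a (u i) = scale (\<sigma> * (- 1) ^ i * (of_nat L - 2 * of_nat i)) (u i)"
    and "inj_on (\<lambda>i. \<sigma> * (- 1) ^ i * (of_nat L - 2 * of_nat i)) {0..diameter}"
    and "\<And>i. scale 2 (gen_act b (u i))
      = u (Suc i) + scale (4 * of_nat i * (of_nat L - of_nat i + 1)) (u (i - 1))"
    and "u (Suc diameter) = scale \<tau> (u diameter)"
proof -
  let ?d = diameter
  interpret C: ladder_chain scale act Basis a b c \<sigma> "of_nat L" "(of_nat L + 1)\<^sup>2" v
    by unfold_locales (use assms in auto)
  have down: "(of_nat L + 1)\<^sup>2 - (of_nat L - 2 * of_nat i - 1)\<^sup>2
      = 4 * of_nat (Suc i) * (of_nat L - of_nat (Suc i) + 1 :: 'k)" for i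
    by (simp add: power2_eq_square algebra_simps)
  have nonzero: "C.u i \<noteq> 0" if "i \<le> ?d" for i
    using that
  proof (induction i)
    case (Suc i)
    have "4 * of_nat (Suc i) * (of_nat L - of_nat i :: 'k) \<noteq> 0"
      using L Suc.prems by (auto simp del: of_nat_Suc)
    then have "ladder b c (C.\<epsilon> i) (C.u (Suc i)) \<noteq> 0"
      using Suc unfolding C.u_down down by simp
    then show ?case by (metis ladder_zero)
  qed (simp add: v)
  \<comment> \<open>Serves both distinctness up to d and the comparison of position d + 1 with those
    before d. Type B excludes equality by parity, type AB by size: i + j is at most 2d.\<close>
  have ne: "of_nat L \<noteq> (of_nat (i + j) :: 'k)" if "i < j" "j \<le> Suc ?d" "odd (i + j)" "i < ?d" for i j
  proof -
    have "L \<noteq> i + j" using L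
    proof
      assume "even ?d \<and> L = ?d"
      then show ?thesis using \<open>odd (i + j)\<close> by metis
    qed (use that in linarith)
    then show ?thesis by (metis of_nat_eq_iff)
  qed
  have inj: "inj_on (\<lambda>i. C.\<epsilon> i * (of_nat L - 2 * of_nat i)) {0..?d}"
  proof (rule C.eigenvalues_inj)
    fix i j assume "i < j" "j \<le> ?d" "odd (i + j)"
    then show "of_nat L \<noteq> (of_nat (i + j) :: 'k)" by (intro ne) simp_all
  qed
  have basis: "basis_of ?d C.u UNIV"
    by (rule eigenbasis[OF linear_gen_act[of a] nonzero C.u_eigen inj dim])
  have eigenvalue_ne: "C.\<epsilon> i * (of_nat L - 2 * of_nat i) \<noteq> C.\<epsilon> (Suc ?d) * (of_nat L - 2 * of_nat (Suc ?d))"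
    if "i < ?d" for i
    using C.eigenvalue_eqD[of i "Suc ?d"] ne[of i "Suc ?d"] that by auto
  \<comment> \<open>For L = 2d + 1 the positions d and d + 1 share their eigenvalue, so the chain
    may continue with a multiple of its last vector instead of zero.\<close>
  obtain \<tau> where \<tau>: "C.u (Suc ?d) = scale \<tau> (C.u ?d)"
  proof -
    obtain \<alpha> where \<alpha>: "C.u (Suc ?d) = (\<Sum>i\<le>?d. scale (\<alpha> i) (C.u i))"
      using basis by (rule basis_of_coordinates)
    have "\<alpha> i = 0" if "i < ?d" for i
      using eigenvector_coordinates[OF basis linear_gen_act C.u_eigen C.u_eigen[of "Suc ?d", unfolded \<alpha>]]
        eigenvalue_ne[OF that] that less_imp_le by blast
    then have "C.u (Suc ?d) = (\<Sum>i\<le>?d. if i = ?d then scale (\<alpha> i) (C.u i) else 0)"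
      unfolding \<alpha> by (intro sum.cong) auto
    then show thesis by (intro that[of "\<alpha> ?d"]) simp
  qed
  have low: "ladder b c (- \<sigma>) v = 0"
  proof -
    let ?w = "ladder b c (- \<sigma>) v"
    have w: "gen_act a ?w = scale (2 * - \<sigma> - \<sigma> * of_nat L) ?w"
      using ladder_eigen[OF abc _ v(2), of "- \<sigma>"] \<sigma> by simp
    obtain \<alpha> where \<alpha>: "?w = (\<Sum>i\<le>?d. scale (\<alpha> i) (C.u i))"
      using basis by (rule basis_of_coordinates)
    have "\<alpha> i = 0" if "i \<le> ?d" for i
    proof -
      have "C.\<epsilon> i * (of_nat L - 2 * of_nat i) \<noteq> 2 * - \<sigma> - \<sigma> * of_nat L" 
      proof
        assume eq: "C.\<epsilon> i * (of_nat L - 2 * of_nat i) = 2 * - \<sigma> - \<sigma> * of_nat L"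
        have "\<sigma> \<noteq> 0" using \<sigma> by auto
        have "\<sigma> * ((- 1) ^ i * (of_nat L - 2 * of_nat i)) = \<sigma> * (- 2 - of_nat L)"
          using eq by (simp add: C.\<epsilon>_def algebra_simps)
        then have "(- 1) ^ i * (of_nat L - 2 * of_nat i) = (- 2 - of_nat L :: 'k)"
          using \<open>\<sigma> \<noteq> 0\<close> by (metis mult_left_cancel)
        then have "of_int ((- 1) ^ i * (int L - 2 * int i)) = (of_int (- 2 - int L) :: 'k)"
          by simp
        then have "(- 1) ^ i * (int L - 2 * int i) = - 2 - int L" by (simp only: of_int_eq_iff)
        then show False using L that by (cases "even i") auto
      qed
      then show ?thesis
        using eigenvector_coordinates[OF basis linear_gen_act C.u_eigen w[unfolded \<alpha>] that] by blast
    qed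
    then show ?thesis unfolding \<alpha> by simp
  qed
  have act_b: "scale 2 (gen_act b (C.u i))
      = C.u (Suc i) + scale (4 * of_nat i * (of_nat L - of_nat i + 1)) (C.u (i - 1))" for i
  proof (cases i)
    case 0
    then show ?thesis using C.act_b_u_0 low by simp
  next
    case (Suc j)
    show ?thesis
      unfolding Suc C.act_b_u_Suc[of j] down by (simp del: C.u.simps of_nat_Suc)
  qed
  show thesis
    by (rule that[OF basis _ _ act_b \<tau>]) (use C.u_eigen inj in \<open>simp_all add: C.\<epsilon>_def\<close>)
qed

lemma tridiagonal_coordinates_nonzero:
  fixes s :: 'k and L :: nat
  assumes u: "basis_of d u UNIV" and top: "u (Suc d) = scale \<tau> (u d)"
    and act: "\<And>i. scale 2 (gen_act b (u i))
      = u (Suc i) + scale (4 * of_nat i * (of_nat L - of_nat i + 1)) (u (i - 1))"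
    and "d \<le> L" and s: "s * s = 1"
    and eigen: "gen_act b (\<Sum>i\<le>d. scale (\<alpha> i) (u i)) = scale (s * of_nat L) (\<Sum>i\<le>d. scale (\<alpha> i) (u i))"
    and nonzero: "(\<Sum>i\<le>d. scale (\<alpha> i) (u i)) \<noteq> 0" and "i \<le> d"
  shows "\<alpha> i \<noteq> 0"
proof -
  define c :: "nat \<Rightarrow> 'k" where "c i = 4 * of_nat i * (of_nat L - of_nat i + 1)" for i
  \<comment> \<open>The coordinates of 2 b v - 2 s L v. The scalar \<open>\<tau>\<close> sits at
    index d, while the recurrence is read off at smaller indices.\<close>
  define \<gamma> where "\<gamma> i = (if i = 0 then 0 else \<alpha> (i - 1)) + (if i < d then \<alpha> (Suc i) * c (Suc i) else 0)
    - 2 * (s * of_nat L) * \<alpha> i + (if i = d then \<alpha> d * \<tau> else 0)" for i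
  have "scale 2 (gen_act b (\<Sum>i\<le>d. scale (\<alpha> i) (u i))) = (\<Sum>i\<le>d. scale (\<alpha> i) (scale 2 (gen_act b (u i))))"
    by (simp add: gen_act_sum gen_act_scale scale_sum_right mult.commute)
  also have "\<dots> = (\<Sum>i\<le>d. scale (\<alpha> i) (u (Suc i))) + (\<Sum>i\<le>d. scale (\<alpha> i * c i) (u (i - 1)))"
    by (simp only: act c_def[symmetric] scale_right_distrib sum.distrib scale_scale)
  also have down: "(\<Sum>i\<le>d. scale (\<alpha> i * c i) (u (i - 1)))
      = (\<Sum>i\<le>d. scale (if i < d then \<alpha> (Suc i) * c (Suc i) else 0) (u i))"
    by (rule shift_down_sum) (simp add: c_def)
  also have "(\<Sum>i\<le>d. scale (\<alpha> i) (u (Suc i))) =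
      (\<Sum>i\<le>d. scale (if i = 0 then 0 else \<alpha> (i - 1)) (u i)) + scale (\<alpha> d * \<tau>) (u d)"
    by (simp only: shift_up_sum top scale_scale)
  also have "scale (\<alpha> d * \<tau>) (u d) = (\<Sum>i\<le>d. scale (if i = d then \<alpha> d * \<tau> else 0) (u i))"
    by (simp add: if_distrib[of "\<lambda>x. scale x _"] cong: if_cong)
  finally have eq: "(\<Sum>i\<le>d. scale (if i = 0 then 0 else \<alpha> (i - 1)) (u i))
      + (\<Sum>i\<le>d. scale (if i = d then \<alpha> d * \<tau> else 0) (u i))
      + (\<Sum>i\<le>d. scale (if i < d then \<alpha> (Suc i) * c (Suc i) else 0) (u i))
      = (\<Sum>i\<le>d. scale (2 * (s * of_nat L) * \<alpha> i) (u i))"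
    by (simp only: eigen scale_sum_right scale_scale mult.assoc)
  have "x + y - z + t = 0" if "x + t + y = z" for x y z t :: 'v
    unfolding that[symmetric] by simp
  from this[OF eq] have "(\<Sum>i\<le>d. scale (\<gamma> i) (u i)) = 0"
    by (simp only: \<gamma>_def scale_left_distrib scale_left_diff_distrib sum.distrib sum_subtractf)
  then have \<gamma>: "\<gamma> i = 0" if "i \<le> d" for i using basis_of_coeffs_zero[OF u] that by blast
  have step: "s * \<alpha> i = 2 * of_nat (Suc i) * \<alpha> (Suc i)" if "i < d" for i
    using that
  proof (induction i)
    case 0
    have "\<gamma> 0 = 0" by (rule \<gamma>) simp
    then have "(4 * of_nat L) * \<alpha> 1 = 2 * (s * of_nat L) * \<alpha> 0" using 0 by (simp add: \<gamma>_def c_def)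
    then have "of_nat L * (s * \<alpha> 0) = of_nat L * (2 * \<alpha> 1)" by (auto simp: mult_ac)
    moreover have "(of_nat L :: 'k) \<noteq> 0" using 0 \<open>d \<le> L\<close> by simp
    ultimately show ?case by simp
  next
    case (Suc i)
    \<comment> \<open>Eliminating \<open>\<alpha> i\<close> by the preceding relation turns the
      three-term equation into \<open>of_nat L - of_nat (Suc i)\<close> times the next two-term
      relation, up to the factor 2.\<close>
    have "\<alpha> i = s * (s * \<alpha> i)" using s by (simp flip: mult.assoc)
    also have "\<dots> = s * (2 * of_nat (Suc i) * \<alpha> (Suc i))" using Suc by simp
    finally have "\<gamma> (Suc i) = s * (2 * of_nat (Suc i) * \<alpha> (Suc i)) + \<alpha> (Suc (Suc i)) * c (Suc (Suc i))
      - 2 * (s * of_nat L) * \<alpha> (Suc i)" using Suc.prems by (simp add: \<gamma>_def del: of_nat_Suc)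
    also have "\<dots> = 2 * ((of_nat L - of_nat (Suc i))
        * (2 * of_nat (Suc (Suc i)) * \<alpha> (Suc (Suc i)) - s * \<alpha> (Suc i)))"
      by (simp add: c_def algebra_simps)
    finally have "2 * ((of_nat L - of_nat (Suc i))
        * (2 * of_nat (Suc (Suc i)) * \<alpha> (Suc (Suc i)) - s * \<alpha> (Suc i))) = 0"
      using \<gamma>[of "Suc i"] Suc.prems by simp
    moreover have "(of_nat L - of_nat (Suc i) :: 'k) \<noteq> 0"
      using Suc.prems \<open>d \<le> L\<close> by (metis leD of_nat_eq_iff right_minus_eq)
    ultimately show ?case by (metis mult_eq_0_iff right_minus_eq zero_neq_numeral)
  qed
  have "s \<noteq> 0" using s by auto
  have "\<alpha> 0 \<noteq> 0"
  proof
    assume "\<alpha> 0 = 0"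
    have "\<alpha> i = 0" if "i \<le> d" for i
      using that
    proof (induction i)
      case (Suc i)
      then show ?case using step[of i] by (simp del: of_nat_Suc)
    qed (use \<open>\<alpha> 0 = 0\<close> in simp)
    then show False using nonzero by simp
  qed
  with \<open>i \<le> d\<close> show ?thesis
  proof (induction i)
    case (Suc i)
    then have "s * \<alpha> i \<noteq> 0" using \<open>s \<noteq> 0\<close> by simp
    then show ?case using step[of i] Suc.prems by auto
  qed simp
qed

text \<open>In an eigenbasis u of a, the vector \<open>prim_idem a i v\<close> is the i-th
  coordinate of v times \<open>u i\<close>, so all claims reduce to nonvanishing coordinates. A
  basis with the single index 0 expresses that one vector spans the range.\<close>

lemma prim_idem_extremal_vector:
  assumes "a \<noteq> b" and v: "v \<in> range (prim_idem b 0)" "v \<noteq> 0"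
  shows "\<And>i. i \<le> diameter \<Longrightarrow> prim_idem a i v \<noteq> 0"
    and "\<And>i. i \<le> diameter \<Longrightarrow> basis_of 0 (\<lambda>_. prim_idem a i v) (range (prim_idem a i))"
    and "basis_of diameter (\<lambda>i. prim_idem a i v) UNIV"
proof -
  let ?d = diameter
  \<comment> \<open>The choice picks some type that the module has; the eigenvalue data are drawn
    from that property.\<close>
  have "has_type type_of" unfolding type_of_def using has_type_exists by (rule someI_ex)
  then obtain s :: "gen \<Rightarrow> 'k" and L where
    L: "even diameter \<and> L = diameter \<or> L = 2 * diameter + 1"
    and s: "\<And>a. s a * s a = 1"
    and theta: "\<And>a i. of_int (theta type_of diameter a i) = s a * (- 1) ^ i * (of_nat L - 2 * of_nat i)"
    and eigenvector: "\<And>a. \<exists>v. v \<noteq> 0 \<and> gen_act a v = scale (s a * of_nat L) v"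
    and level: "casimir_level ((of_nat L + 1)\<^sup>2)"
    and dim: "dim UNIV = Suc diameter"
    by (rule type_data) (rule that, assumption+)
  have eigval: "eigval a i = s a * (- 1) ^ i * (of_nat L - 2 * of_nat i)" for a i
    by (simp only: eigval_def theta)
  have eigval_fun: "eigval a = (\<lambda>i. s a * (- 1) ^ i * (of_nat L - 2 * of_nat i))" for a
    using eigval by blast
  \<comment> \<open>A chain for b itself identifies the range of \<open>prim_idem b 0\<close> as the
    extremal eigenspace of b.\<close>
  have eigen_b: "gen_act b v = scale (s b * of_nat L) v"
  proof -
    obtain a' c where "distinct [b, a', c]" by (rule distinct_gens_exist)
    moreover obtain w where "w \<noteq> 0" "gen_act b w = scale (s b * of_nat L) w" using eigenvector by blast
    ultimately obtain u where u: "basis_of ?d u UNIV"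
      "\<And>i. gen_act b (u i) = scale (s b * (- 1) ^ i * (of_nat L - 2 * of_nat i)) (u i)"
      "inj_on (\<lambda>i. s b * (- 1) ^ i * (of_nat L - 2 * of_nat i)) {0..?d}"
      by (rule ladder_eigenbasis[OF _ L s level _ _ dim]) (rule that, assumption+)
    obtain x where "v = prim_idem b 0 x" using v(1) by blast
    moreover obtain \<alpha> where "x = (\<Sum>j\<le>?d. scale (\<alpha> j) (u j))" using u(1) by (rule basis_of_coordinates)
    ultimately have "v = scale (\<alpha> 0) (u 0)"
      using prim_idem_eigenbasis[OF u(1), of b 0 \<alpha>] u(2,3) by (simp add: eigval_fun)
    then show ?thesis using u(2)[of 0] by (simp add: gen_act_scale mult.commute)
  qed
  obtain c where abc: "distinct [a, b, c]"
    using \<open>a \<noteq> b\<close> by (cases a; cases b) (auto intro: that[of Gx] that[of Gy] that[of Gz])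
  obtain w where w: "w \<noteq> 0" "gen_act a w = scale (s a * of_nat L) w" using eigenvector by blast
  obtain u \<tau> where u: "basis_of ?d u UNIV"
    and eigen: "\<And>i. gen_act a (u i) = scale (eigval a i) (u i)"
    and inj: "inj_on (eigval a) {0..?d}"
    and act_b: "\<And>i. scale 2 (gen_act b (u i))
      = u (Suc i) + scale (4 * of_nat i * (of_nat L - of_nat i + 1)) (u (i - 1))"
    and top: "u (Suc ?d) = scale \<tau> (u ?d)"
    by (rule ladder_eigenbasis[OF abc L s[of a] level w dim, folded eigval]) (rule that, (simp only: eigval_fun)+)
  have idem: "prim_idem a i (\<Sum>j\<le>?d. scale (\<alpha> j) (u j)) = scale (\<alpha> i) (u i)" if "i \<le> ?d" for i \<alpha>
    by (rule prim_idem_eigenbasis[OF u eigen inj that])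
  obtain \<alpha> where \<alpha>: "v = (\<Sum>j\<le>?d. scale (\<alpha> j) (u j))" using u by (rule basis_of_coordinates)
  have "?d \<le> L" using L by auto
  have nz: "\<alpha> i \<noteq> 0" if "i \<le> ?d" for i
    by (rule tridiagonal_coordinates_nonzero[OF u top act_b \<open>?d \<le> L\<close> s[of b] _ _ that])
      (use eigen_b v(2) \<alpha> in simp_all)
  have u_nz: "u i \<noteq> 0" if "i \<le> ?d" for i using basis_of_nonzero[OF u that] .
  have idem_v: "prim_idem a i v = scale (\<alpha> i) (u i)" if "i \<le> ?d" for i
    unfolding \<alpha> by (rule idem[OF that])
  show nonzero: "prim_idem a i v \<noteq> 0" if "i \<le> ?d" for i
    using that by (simp add: idem_v nz u_nz)
  show "basis_of 0 (\<lambda>_. prim_idem a i v) (range (prim_idem a i))" if "i \<le> ?d" for i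
  proof -
    have "range (prim_idem a i) = span {prim_idem a i v}"
    proof
      show "range (prim_idem a i) \<subseteq> span {prim_idem a i v}"
      proof
        fix y assume "y \<in> range (prim_idem a i)"
        then obtain x where y: "y = prim_idem a i x" by blast
        obtain \<beta> where "x = (\<Sum>j\<le>?d. scale (\<beta> j) (u j))" using u by (rule basis_of_coordinates)
        then have "y = scale (\<beta> i / \<alpha> i) (prim_idem a i v)"
          using that by (simp add: y idem idem_v nz)
        then show "y \<in> span {prim_idem a i v}" by (simp add: span_scale span_base)
      qed
    next
      show "span {prim_idem a i v} \<subseteq> range (prim_idem a i)"
      proof
        fix y assume "y \<in> span {prim_idem a i v}"
        then obtain k where "y = scale k (prim_idem a i v)" by (auto simp: span_singleton)
        then have "y = prim_idem a i (\<Sum>j\<le>?d. scale (k * \<alpha> j) (u j))"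
          using that idem[of i "\<lambda>j. k * \<alpha> j"] by (simp add: idem_v)
        then show "y \<in> range (prim_idem a i)" by blast
      qed
    qed
    then show ?thesis using nonzero[OF that] by (simp add: basis_of_def)
  qed
  show "basis_of ?d (\<lambda>i. prim_idem a i v) UNIV"
    by (rule eigenbasis[OF linear_gen_act[of a] nonzero _ inj dim])
      (simp_all add: idem_v gen_act_scale eigen mult.commute)
qed

end

theorem theorem6p3:
  fixes scale :: "'k::{alg_closed_field, field_char_0} \<Rightarrow> 'v::ab_group_add \<Rightarrow> 'v"
    and act :: "'k acs_alg \<Rightarrow> 'v \<Rightarrow> 'v"
    and d :: nat and a b :: gen
  assumes "acs_module scale act"
    and "\<exists>Basis. finite_dimensional_vector_space scale Basis"
    and "acs_module.irreducible_module scale act"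
    and "d = vector_space.diameter scale"
    and "a \<noteq> b"
  shows "\<forall>v \<in> range (acs_module.prim_idem scale act b 0). v \<noteq> 0 \<longrightarrow>
    (\<forall>i\<le>d.
      acs_module.prim_idem scale act a i v \<noteq> 0 \<and>
      vector_space.basis_of scale 0 (\<lambda>_. acs_module.prim_idem scale act a i v)
        (range (acs_module.prim_idem scale act a i))) \<and>
    vector_space.basis_of scale d (\<lambda>i. acs_module.prim_idem scale act a i v) UNIV"
proof -
  obtain Basis where "finite_dimensional_vector_space scale Basis" using assms(2) by blast
  then interpret irreducible_acs_module scale act Basis
    by (intro irreducible_acs_module.intro irreducible_acs_module_axioms.intro assms(1,3))
  show ?thesis
    unfolding assms(4) using prim_idem_extremal_vector[OF assms(5)] by blast
qed

end
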